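(* Let $(\Omega,\mathscr H,\widehat{\mathbb E})$ be a sub-linear expectation space with a sequence of independent and identically distributed random variables $\{X_n;n\ge1\}$. Consider the subspace $$\widetilde{\mathscr H}=\left\{Y=\varphi(X_1,\dots,X_n):\ \varphi\in C_{l,Lip}(\mathbb R^n),\ \widehat{\mathbb E}[(|Y|-c)^+]\to0\text{ as }c\to\infty,\ n\ge1\right\}.$$ Suppose the following condition (CC) is satisfied: with $\mathscr H_b=\{f\in\mathscr H:f\text{ is bounded}\}$, $$\widehat{\mathbb E}[X]=\sup_{P\in\mathscr P}P[X],\qquad X\in\mathscr H_b,$$ where $\mathscr P$ is a countable-dimensionally weakly compact family of probability measures on $(\Omega,\sigma(\mathscr H))$, in the sense that for any $Y_1,Y_2,\dots\in\mathscr H_b$ and any sequence $\{P_n\}\subset\mathscr P$ there are a subsequence $\{n_k\}$ and a probability measure $P\in\mathscr P$ for which $$\lim_{k\to\infty}P_{n_k}[\varphi(Y_1,\dots,Y_d)]=P[\varphi(Y_1,\dots,Y_d)],\qquad\varphi\in C_{b,Lip}(\mathbb R^d),\ d\ge1.$$ Define $\mathbb V^{\mathscr P}(A)=\sup_{P\in\mathscr P}P(A)$ for $A\in\sigma(\mathscr H)$. Then, for $\mathbb V=\mathbb V^{\mathscr P}$, $\mathbb C^*$, $\widehat{\mathbb V}^*$ or $\widehat{\mathbb V}$: (i) $\mathbb V$ has the property that $\widehat{\mathbb E}[f]\le\mathbb V(A)\le\widehat{\mathbb E}[g]$ whenever $f\le I_A\le g$ with $f,g\in\mathscr H$ and $A$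 an event; (ii) if on $\sigma(X_1,X_2,\dots)$ the capacity $\mathbb V$ has the property that $$\mathbb V\Big(\bigcap_{i=1}^\infty A_i\Big)>0\quad\text{for all events }\{A_n\}\text{ with }A_n\supset A_{n+1}\text{ and }\mathbb V(A_n)=1,\ n=1,2,\dots,$$ then $\widehat{\mathbb E}$ is linear on $\widetilde{\mathscr H}$.
   Context: Sub-linear expectation space: $(\Omega,\mathcal F)$ is a measurable space and $\mathscr H$ is a linear space of real measurable functions on it such that $\varphi(X_1,\dots,X_n)\in\mathscr H$ whenever $X_1,\dots,X_n\in\mathscr H$ and $\varphi\in C_{l,Lip}(\mathbb R^n)$, where $C_{l,Lip}(\mathbb R^n)$ is the set of $\varphi$ with $|\varphi(x)-\varphi(y)|\le C(1+|x|^m+|y|^m)|x-y|$ for some $C>0$, $m\in\mathbb N$ depending on $\varphi$; $C_{b,Lip}(\mathbb R^n)$ is the space of bounded Lipschitz functions. A sub-linear expectation is a map $\widehat{\mathbb E}:\mathscr H\to[-\infty,\infty]$ such that: $X\ge Y$ implies $\widehat{\mathbb E}[X]\ge\widehat{\mathbb E}[Y]$; $\widehat{\mathbb E}[c]=c$ for constants $c$; $\widehat{\mathbb E}[X+Y]\le\widehat{\mathbb E}[X]+\widehat{\mathbb E}[Y]$ whenever the right side is not of the form $\infty-\infty$; $\widehat{\mathbb E}[\lambda X]=\lambda\widehat{\mathbb E}[X]$ for $\lambda\ge0$ (with $0\cdot\infty=0$). Elements of $\mathscr H$ are called random variables. For a probability measure $P$, $P[X]=\int X\,dP$. Independence: a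 random vector $\bm Y\in\mathscr H^n$ is independent to $\bm X\in\mathscr H^m$ if $\widehat{\mathbb E}[\varphi(\bm X,\bm Y)]=\widehat{\mathbb E}\big[\widehat{\mathbb E}[\varphi(\bm x,\bm Y)]|_{\bm x=\bm X}\big]$ for each $\varphi\in C_{l,Lip}(\mathbb R^m\times\mathbb R^n)$ with $\overline\varphi(\bm x):=\widehat{\mathbb E}[|\varphi(\bm x,\bm Y)|]<\infty$ for all $\bm x$ and $\widehat{\mathbb E}[|\overline\varphi(\bm X)|]<\infty$. A sequence $\{X_n\}$ is independent if $X_{i+1}$ is independent to $(X_1,\dots,X_i)$ for each $i\ge1$; it is identically distributed if $\widehat{\mathbb E}[\varphi(X_i)]=\widehat{\mathbb E}[\varphi(X_1)]$ for all $\varphi\in C_{b,Lip}(\mathbb R)$ and all $i$. Capacities generated by $\widehat{\mathbb E}$ (for events $A$): $\widehat{\mathbb V}(A)=\inf\{\widehat{\mathbb E}[\xi]:I_A\le\xi,\ \xi\in\mathscr H\}$; $\widehat{\mathbb V}^*(A)=\inf\{\sum_{n=1}^\infty\widehat{\mathbb V}(A_n):A\subset\bigcup_{n=1}^\infty A_n\}$; $\mathbb C^*(A)=\inf\{\lim_{n\to\infty}\widehat{\mathbb E}[\sum_{i=1}^ng_i]:I_A\le\sum_{n=1}^\infty g_n,\ 0\le g_n\in\mathscr H\}$. In (i), "event" means a set in the domain of the capacity considered ($\sigma(\mathscr H)$ for $\mathbb V^{\mathscr P}$). *)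

theory Defs
  imports "HOL-Probability.Probability"
begin

text \<open>
  A vector in \<open>\<real>\<^sup>n\<close> is represented by \<open>x :: nat \<Rightarrow> real\<close>, of which only the coordinates
  \<open>x i\<close> with \<open>i < n\<close> count; its Euclidean norm is \<open>L2_set x {..<n}\<close>. The inequalities in
  \<open>C_lLip n\<close> and \<open>C_bLip n\<close> force a function in either class to depend on the first \<open>n\<close>
  coordinates only, so that these are function classes on \<open>\<real>\<^sup>n\<close>.
\<close>

definition C_lLip :: "nat \<Rightarrow> ((nat \<Rightarrow> real) \<Rightarrow> real) set" where
  "C_lLip n = {\<phi>. \<exists>C>0. \<exists>m::nat. \<forall>x y.
     \<bar>\<phi> x - \<phi> y\<bar> \<le> C * (1 + L2_set x {..<n} ^ m + L2_set y {..<n} ^ m)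
                        * L2_set (\<lambda>i. x i - y i) {..<n}}"

definition C_bLip :: "nat \<Rightarrow> ((nat \<Rightarrow> real) \<Rightarrow> real) set" where
  "C_bLip n = {\<phi>. bounded (range \<phi>) \<and>
     (\<exists>L. \<forall>x y. \<bar>\<phi> x - \<phi> y\<bar> \<le> L * L2_set (\<lambda>i. x i - y i) {..<n})}"

text \<open>The vector \<open>(x, y) \<in> \<real>\<^sup>m \<times> \<real>\<^sup>n = \<real>\<^bsup>m+n\<^esup>\<close>.\<close>

definition vec_join :: "nat \<Rightarrow> (nat \<Rightarrow> real) \<Rightarrow> (nat \<Rightarrow> real) \<Rightarrow> nat \<Rightarrow> real" where
  "vec_join m x y = (\<lambda>i. if i < m then x i else y (i - m))"

text \<open>
  The measurable space \<open>(\<Omega>, \<F>)\<close> is given by \<open>M\<close>; the measure carried by \<open>M\<close> is irrelevant.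
  Only the values of the functional \<open>E\<close> on \<open>H\<close> are constrained.
\<close>

locale sublinear_expectation_space =
  fixes M :: "'a measure" and H :: "('a \<Rightarrow> real) set" and E :: "('a \<Rightarrow> real) \<Rightarrow> ereal"
  assumes measurable: "X \<in> H \<Longrightarrow> X \<in> borel_measurable M"
    and zero: "(\<lambda>\<omega>. 0) \<in> H"
    and add: "X \<in> H \<Longrightarrow> Y \<in> H \<Longrightarrow> (\<lambda>\<omega>. X \<omega> + Y \<omega>) \<in> H"
    and scale: "X \<in> H \<Longrightarrow> (\<lambda>\<omega>. a * X \<omega>) \<in> H"
    and compose: "n \<ge> 1 \<Longrightarrow> \<phi> \<in> C_lLip n \<Longrightarrow> (\<And>i. i < n \<Longrightarrow> Z i \<in> H)
                    \<Longrightarrow> (\<lambda>\<omega>. \<phi> (\<lambda>i. Z i \<omega>)) \<in> H"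
    and E_mono: "X \<in> H \<Longrightarrow> Y \<in> H \<Longrightarrow> (\<And>\<omega>. \<omega> \<in> space M \<Longrightarrow> Y \<omega> \<le> X \<omega>) \<Longrightarrow> E Y \<le> E X"
    and E_const: "E (\<lambda>\<omega>. c) = ereal c"
    and E_subadd: "X \<in> H \<Longrightarrow> Y \<in> H
                    \<Longrightarrow> \<not> (E X = \<infinity> \<and> E Y = -\<infinity>) \<Longrightarrow> \<not> (E X = -\<infinity> \<and> E Y = \<infinity>)
                    \<Longrightarrow> E (\<lambda>\<omega>. X \<omega> + Y \<omega>) \<le> E X + E Y"
    and E_scale: "X \<in> H \<Longrightarrow> a \<ge> 0 \<Longrightarrow> E (\<lambda>\<omega>. a * X \<omega>) = ereal a * E X"

text \<open>
  \<open>indep_to H E n Y m X\<close>: the random vector \<open>Y \<in> H\<^sup>n\<close> is independent to \<open>X \<in> H\<^sup>m\<close>.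
  The maps \<open>x \<mapsto> E[|\<phi>(x, Y)|]\<close> and \<open>x \<mapsto> E[\<phi>(x, Y)]\<close> are finite under the condition on \<open>\<phi>\<close>,
  but, composed with \<open>X\<close>, need not belong to the domain \<open>H\<close> of \<open>E\<close>; the identity is required
  for those \<open>\<phi>\<close> for which they do, i.e. for which all expectations involved are defined.
\<close>

definition indep_to ::
  "('a \<Rightarrow> real) set \<Rightarrow> (('a \<Rightarrow> real) \<Rightarrow> ereal) \<Rightarrow> nat \<Rightarrow> (nat \<Rightarrow> 'a \<Rightarrow> real)
     \<Rightarrow> nat \<Rightarrow> (nat \<Rightarrow> 'a \<Rightarrow> real) \<Rightarrow> bool" where
  "indep_to H E n Y m X \<longleftrightarrow>
     (\<forall>\<phi> \<in> C_lLip (m + n).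
        let abs_bar = (\<lambda>x. E (\<lambda>\<omega>. \<bar>\<phi> (vec_join m x (\<lambda>i. Y i \<omega>))\<bar>));
            bar = (\<lambda>x. E (\<lambda>\<omega>. \<phi> (vec_join m x (\<lambda>i. Y i \<omega>))));
            abs_bar_X = (\<lambda>\<omega>. real_of_ereal (abs_bar (\<lambda>i. X i \<omega>)));
            bar_X = (\<lambda>\<omega>. real_of_ereal (bar (\<lambda>i. X i \<omega>)))
        in (\<forall>x. abs_bar x < \<infinity>) \<longrightarrow> abs_bar_X \<in> H \<longrightarrow> bar_X \<in> H
           \<longrightarrow> E (\<lambda>\<omega>. \<bar>abs_bar_X \<omega>\<bar>) < \<infinity>
           \<longrightarrow> E (\<lambda>\<omega>. \<phi> (vec_join m (\<lambda>i. X i \<omega>) (\<lambda>i. Y i \<omega>))) = E bar_X)"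

text \<open>Sequences are indexed from \<open>0\<close>: the sequence \<open>X\<^sub>1, X\<^sub>2, \<dots>\<close> is \<open>X 0, X 1, \<dots>\<close>.\<close>

definition indep_seq ::
  "('a \<Rightarrow> real) set \<Rightarrow> (('a \<Rightarrow> real) \<Rightarrow> ereal) \<Rightarrow> (nat \<Rightarrow> 'a \<Rightarrow> real) \<Rightarrow> bool" where
  "indep_seq H E X \<longleftrightarrow> (\<forall>i\<ge>1. indep_to H E 1 (\<lambda>_. X i) i X)"

definition ident_distr_seq ::
  "(('a \<Rightarrow> real) \<Rightarrow> ereal) \<Rightarrow> (nat \<Rightarrow> 'a \<Rightarrow> real) \<Rightarrow> bool" where
  "ident_distr_seq E X \<longleftrightarrow>
     (\<forall>i. \<forall>\<phi> \<in> C_bLip 1. E (\<lambda>\<omega>. \<phi> (\<lambda>_. X i \<omega>)) = E (\<lambda>\<omega>. \<phi> (\<lambda>_. X 0 \<omega>)))"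

definition H_tilde ::
  "(('a \<Rightarrow> real) \<Rightarrow> ereal) \<Rightarrow> (nat \<Rightarrow> 'a \<Rightarrow> real) \<Rightarrow> ('a \<Rightarrow> real) set" where
  "H_tilde E X = {Y. (\<exists>n\<ge>1. \<exists>\<phi> \<in> C_lLip n. Y = (\<lambda>\<omega>. \<phi> (\<lambda>i. X i \<omega>))) \<and>
     ((\<lambda>c::real. E (\<lambda>\<omega>. max (\<bar>Y \<omega>\<bar> - c) 0)) \<longlongrightarrow> 0) at_top}"

definition linear_expectation_on ::
  "('a \<Rightarrow> real) set \<Rightarrow> (('a \<Rightarrow> real) \<Rightarrow> ereal) \<Rightarrow> bool" where
  "linear_expectation_on K E \<longleftrightarrow>
     (\<forall>Y\<in>K. \<bar>E Y\<bar> \<noteq> \<infinity>) \<and>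
     (\<forall>Y\<in>K. \<forall>Z\<in>K. \<forall>a b. E (\<lambda>\<omega>. a * Y \<omega> + b * Z \<omega>) = ereal a * E Y + ereal b * E Z)"

definition H_bdd :: "'a measure \<Rightarrow> ('a \<Rightarrow> real) set \<Rightarrow> ('a \<Rightarrow> real) set" where
  "H_bdd M H = {f \<in> H. bounded (f ` space M)}"

text \<open>The measurable space \<open>(\<Omega>, \<sigma>(K))\<close>.\<close>

definition sigma_gen :: "'a measure \<Rightarrow> ('a \<Rightarrow> real) set \<Rightarrow> 'a measure" where
  "sigma_gen M K = sigma (space M) {f -` B \<inter> space M | f B. f \<in> K \<and> B \<in> sets borel}"

definition ctbl_dim_weakly_compact ::
  "'a measure \<Rightarrow> ('a \<Rightarrow> real) set \<Rightarrow> 'a measure set \<Rightarrow> bool" where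
  "ctbl_dim_weakly_compact M H \<P> \<longleftrightarrow>
     (\<forall>Y Q. range Y \<subseteq> H_bdd M H \<longrightarrow> range Q \<subseteq> \<P> \<longrightarrow>
        (\<exists>r :: nat \<Rightarrow> nat. strict_mono r \<and> (\<exists>P\<in>\<P>. \<forall>d\<ge>1. \<forall>\<phi> \<in> C_bLip d.
           (\<lambda>k. \<integral>\<omega>. \<phi> (\<lambda>i::nat. Y i \<omega>) \<partial>(Q (r k))) \<longlonglongrightarrow> (\<integral>\<omega>. \<phi> (\<lambda>i. Y i \<omega>) \<partial>P))))"

definition condition_CC ::
  "'a measure \<Rightarrow> ('a \<Rightarrow> real) set \<Rightarrow> (('a \<Rightarrow> real) \<Rightarrow> ereal) \<Rightarrow> 'a measure set \<Rightarrow> bool" where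
  "condition_CC M H E \<P> \<longleftrightarrow>
     (\<forall>P\<in>\<P>. prob_space P \<and> sets P = sets (sigma_gen M H)) \<and>
     ctbl_dim_weakly_compact M H \<P> \<and>
     (\<forall>X \<in> H_bdd M H. E X = (SUP P\<in>\<P>. ereal (\<integral>\<omega>. X \<omega> \<partial>P)))"

definition V_fam :: "'a measure set \<Rightarrow> 'a set \<Rightarrow> ereal" where
  "V_fam \<P> A = (SUP P\<in>\<P>. ereal (measure P A))"

definition V_hat ::
  "'a measure \<Rightarrow> ('a \<Rightarrow> real) set \<Rightarrow> (('a \<Rightarrow> real) \<Rightarrow> ereal) \<Rightarrow> 'a set \<Rightarrow> ereal" where
  "V_hat M H E A = (INF \<xi> \<in> {\<xi> \<in> H. \<forall>\<omega>\<in>space M. indicator A \<omega> \<le> \<xi> \<omega>}. E \<xi>)"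

definition V_hat_star ::
  "'a measure \<Rightarrow> ('a \<Rightarrow> real) set \<Rightarrow> (('a \<Rightarrow> real) \<Rightarrow> ereal) \<Rightarrow> 'a set \<Rightarrow> ereal" where
  "V_hat_star M H E A =
     (INF B \<in> {B :: nat \<Rightarrow> 'a set. range B \<subseteq> sets M \<and> A \<subseteq> (\<Union>n. B n)}. \<Sum>n. V_hat M H E (B n))"

text \<open>The series of the \<open>g n\<close> is taken in the extended reals, as it may diverge.\<close>

definition C_star ::
  "'a measure \<Rightarrow> ('a \<Rightarrow> real) set \<Rightarrow> (('a \<Rightarrow> real) \<Rightarrow> ereal) \<Rightarrow> 'a set \<Rightarrow> ereal" where
  "C_star M H E A =
     (INF g \<in> {g :: nat \<Rightarrow> 'a \<Rightarrow> real. (\<forall>n. g n \<in> H) \<and> (\<forall>n. \<forall>\<omega>\<in>space M. 0 \<le> g n \<omega>) \<and>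
                (\<forall>\<omega>\<in>space M. indicator A \<omega> \<le> (\<Sum>n. ereal (g n \<omega>)))}.
        lim (\<lambda>n. E (\<lambda>\<omega>. \<Sum>i<n. g i \<omega>)))"

definition sandwich_property ::
  "'a measure \<Rightarrow> ('a \<Rightarrow> real) set \<Rightarrow> (('a \<Rightarrow> real) \<Rightarrow> ereal)
     \<Rightarrow> ('a set \<Rightarrow> ereal) \<Rightarrow> 'a set set \<Rightarrow> bool" where
  "sandwich_property M H E V \<A> \<longleftrightarrow>
     (\<forall>A\<in>\<A>. \<forall>f\<in>H. \<forall>g\<in>H.
        (\<forall>\<omega>\<in>space M. f \<omega> \<le> indicator A \<omega> \<and> indicator A \<omega> \<le> g \<omega>) \<longrightarrow>
        E f \<le> V A \<and> V A \<le> E g)"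

definition decreasing_property :: "('a set \<Rightarrow> ereal) \<Rightarrow> 'a set set \<Rightarrow> bool" where
  "decreasing_property V \<A> \<longleftrightarrow>
     (\<forall>A :: nat \<Rightarrow> 'a set. (\<forall>n. A n \<in> \<A>) \<longrightarrow> (\<forall>n. A (Suc n) \<subseteq> A n) \<longrightarrow> (\<forall>n. V (A n) = 1)
        \<longrightarrow> V (\<Inter>n. A n) > 0)"

end

theory Submission
  imports Defs
begin

text \<open>
  If \<open>\<psi>(X\<^sub>0)\<close> has no certain mean, then a small multiple \<open>u\<close> of \<open>\<psi> - c\<close> satisfies
  \<open>E[u(X\<^sub>0)] = E[- u(X\<^sub>0)] = e > 0\<close>. With \<open>r = 1 - e/2\<close> both \<open>(1 - u)/r\<close> and \<open>(1 + u)/r\<close> have lower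
  expectation \<open>q < 1\<close>, while their product is at least \<open>1\<close>. For every sequence of signs, independence
  bounds the lower expectation of the sum over \<open>j \<ge> J\<close> of the products of such factors over disjoint blocks
  of lengths \<open>j\<close> by the tail of a geometric series, and weak compactness yields some \<open>P \<in> \<P>\<close> under which
  all these products are below \<open>1\<close> with probability close to \<open>1\<close>. So the event that eventually all block
  products are below \<open>1\<close> has full capacity, and sequences of signs that differ infinitely often give disjoint
  events. Infinitely many disjoint events \<open>B\<^sub>m\<close> of full capacity contradict the continuity assumption, since
  \<open>\<Union>\<^sub>m\<^sub>\<ge>\<^sub>n B\<^sub>m\<close> decreases to the empty set. So bounded Lipschitz functions of \<open>X\<^sub>0\<close> have certain means;
  independence and truncation extend this to \<open>H_tilde\<close>.
\<close>

section \<open>Function classes\<close>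

lemma C_bLipI:
  assumes "\<And>x. \<bar>\<phi> x\<bar> \<le> K"
    and "\<And>x y. \<bar>\<phi> x - \<phi> y\<bar> \<le> L * L2_set (\<lambda>i. x i - y i) {..<n}"
  shows "\<phi> \<in> C_bLip n"
  using assms unfolding C_bLip_def bounded_iff by auto

lemma C_bLipE:
  assumes "\<phi> \<in> C_bLip n"
  obtains K L where "K \<ge> 0" "L \<ge> 0" "\<And>x. \<bar>\<phi> x\<bar> \<le> K"
    and "\<And>x y. \<bar>\<phi> x - \<phi> y\<bar> \<le> L * L2_set (\<lambda>i. x i - y i) {..<n}"
proof -
  obtain K L where K: "\<And>x. \<bar>\<phi> x\<bar> \<le> K"
    and L: "\<And>x y. \<bar>\<phi> x - \<phi> y\<bar> \<le> L * L2_set (\<lambda>i. x i - y i) {..<n}"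
    using assms unfolding C_bLip_def bounded_iff by auto
  have "\<bar>\<phi> x - \<phi> y\<bar> \<le> \<bar>L\<bar> * L2_set (\<lambda>i. x i - y i) {..<n}" for x y
    by (rule order_trans[OF L mult_right_mono]) auto
  moreover have "K \<ge> 0" using K[of undefined] by linarith
  ultimately show ?thesis using K that[of K "\<bar>L\<bar>"] by auto
qed

lemma C_bLip_const: "(\<lambda>_. c) \<in> C_bLip n"
  by (rule C_bLipI[where K="\<bar>c\<bar>" and L=0]) auto

lemma C_bLip_add:
  assumes "f \<in> C_bLip n" "g \<in> C_bLip n"
  shows "(\<lambda>x. f x + g x) \<in> C_bLip n"
proof -
  obtain K L where f: "\<And>x. \<bar>f x\<bar> \<le> K"
    "\<And>x y. \<bar>f x - f y\<bar> \<le> L * L2_set (\<lambda>i. x i - y i) {..<n}"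
    using assms(1) by (elim C_bLipE) blast
  obtain K' L' where g: "\<And>x. \<bar>g x\<bar> \<le> K'"
    "\<And>x y. \<bar>g x - g y\<bar> \<le> L' * L2_set (\<lambda>i. x i - y i) {..<n}"
    using assms(2) by (elim C_bLipE) blast
  show ?thesis
  proof (rule C_bLipI)
    show "\<bar>f x + g x\<bar> \<le> K + K'" for x
      using f(1)[of x] g(1)[of x] by linarith
    show "\<bar>(f x + g x) - (f y + g y)\<bar> \<le> (L + L') * L2_set (\<lambda>i. x i - y i) {..<n}" for x y
      using f(2)[of x y] g(2)[of x y] by (simp add: distrib_right)
  qed
qed

lemma C_bLip_mult:
  assumes "f \<in> C_bLip n" "g \<in> C_bLip n"
  shows "(\<lambda>x. f x * g x) \<in> C_bLip n"
proof -
  obtain K L where f: "\<And>x. \<bar>f x\<bar> \<le> K" "K \<ge> 0" "L \<ge> 0"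
    "\<And>x y. \<bar>f x - f y\<bar> \<le> L * L2_set (\<lambda>i. x i - y i) {..<n}"
    using assms(1) by (elim C_bLipE) blast
  obtain K' L' where g: "\<And>x. \<bar>g x\<bar> \<le> K'" "K' \<ge> 0" "L' \<ge> 0"
    "\<And>x y. \<bar>g x - g y\<bar> \<le> L' * L2_set (\<lambda>i. x i - y i) {..<n}"
    using assms(2) by (elim C_bLipE) blast
  show ?thesis
  proof (rule C_bLipI)
    show "\<bar>f x * g x\<bar> \<le> K * K'" for x
      unfolding abs_mult using f g by (intro mult_mono) auto
    show "\<bar>f x * g x - f y * g y\<bar> \<le> (K * L' + K' * L) * L2_set (\<lambda>i. x i - y i) {..<n}"
      (is "_ \<le> _ * ?D") for x y
    proof -
      have "f x * g x - f y * g y = f x * (g x - g y) + g y * (f x - f y)"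
        by (simp add: algebra_simps)
      also have "\<bar>\<dots>\<bar> \<le> \<bar>f x\<bar> * \<bar>g x - g y\<bar> + \<bar>g y\<bar> * \<bar>f x - f y\<bar>"
        by (metis abs_mult abs_triangle_ineq)
      also have "\<dots> \<le> K * (L' * ?D) + K' * (L * ?D)"
        using f g by (intro add_mono mult_mono) auto
      finally show ?thesis by (simp add: algebra_simps)
    qed
  qed
qed

lemma C_bLip_scale: "f \<in> C_bLip n \<Longrightarrow> (\<lambda>x. c * f x) \<in> C_bLip n"
  using C_bLip_mult[OF C_bLip_const] by blast

lemma C_bLip_uminus: "f \<in> C_bLip n \<Longrightarrow> (\<lambda>x. - f x) \<in> C_bLip n"
  using C_bLip_scale[of f n "-1"] by simp

lemma C_bLip_abs: "f \<in> C_bLip n \<Longrightarrow> (\<lambda>x. \<bar>f x\<bar>) \<in> C_bLip n"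
  by (elim C_bLipE, rule C_bLipI) (auto intro: order_trans[OF abs_triangle_ineq3])

lemma C_bLip_sum: "(\<And>j. j \<in> A \<Longrightarrow> f j \<in> C_bLip n) \<Longrightarrow> (\<lambda>x. \<Sum>j\<in>A. f j x) \<in> C_bLip n"
  by (induction A rule: infinite_finite_induct) (auto intro: C_bLip_add C_bLip_const)

lemma C_bLip_prod: "(\<And>j. j \<in> A \<Longrightarrow> f j \<in> C_bLip n) \<Longrightarrow> (\<lambda>x. \<Prod>j\<in>A. f j x) \<in> C_bLip n"
  by (induction A rule: infinite_finite_induct) (auto intro: C_bLip_mult C_bLip_const)

lemma C_bLip_mono:
  assumes "n \<le> m" "f \<in> C_bLip n"
  shows "f \<in> C_bLip m"
  using assms(2)
proof (rule C_bLipE)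
  fix K L assume L: "K \<ge> 0" "L \<ge> 0" and *: "\<And>x. \<bar>f x\<bar> \<le> K"
    "\<And>x y. \<bar>f x - f y\<bar> \<le> L * L2_set (\<lambda>i. x i - y i) {..<n}"
  have "L * L2_set (\<lambda>i. x i - y i) {..<n} \<le> L * L2_set (\<lambda>i. x i - y i) {..<m}" for x y
    using assms(1) L unfolding L2_set_def
    by (intro mult_left_mono real_sqrt_le_mono sum_mono2) auto
  then show ?thesis using * by (blast intro: C_bLipI order_trans)
qed

section \<open>Functions of a single coordinate\<close>

lemma C_bLip_coord:
  assumes h: "\<And>a. \<bar>h a\<bar> \<le> K" "\<And>a b. \<bar>h a - h b\<bar> \<le> L * \<bar>a - b\<bar>" and "i < n"
  shows "(\<lambda>x. h (x i)) \<in> C_bLip n"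
proof (rule C_bLipI)
  show "\<bar>h (x i)\<bar> \<le> K" for x :: "nat \<Rightarrow> real" by (rule h)
  have "L \<ge> 0" using order_trans[OF abs_ge_zero h(2)[of 0 1]] by simp
  have "\<bar>x i - y i\<bar> \<le> L2_set (\<lambda>i. x i - y i) {..<n}" for x y :: "nat \<Rightarrow> real"
    using member_le_L2_set[of "{..<n}" i "\<lambda>i. \<bar>x i - y i\<bar>"] \<open>i < n\<close>
    unfolding L2_set_def by simp
  then show "\<bar>h (x i) - h (y i)\<bar> \<le> L * L2_set (\<lambda>i. x i - y i) {..<n}" for x y
    using h(2)[of "x i" "y i"] \<open>L \<ge> 0\<close> by (meson mult_left_mono order_trans)
qed

text \<open>A function of one real variable is represented by its values at constant sequences,
  where the norm over \<open>{..<1}\<close> is the absolute value.\<close>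

lemma C_bLip_1E:
  assumes "\<psi> \<in> C_bLip 1"
  obtains K L where "L \<ge> 0" "\<And>a. \<bar>\<psi> (\<lambda>_. a)\<bar> \<le> K"
    "\<And>a b. \<bar>\<psi> (\<lambda>_. a) - \<psi> (\<lambda>_. b)\<bar> \<le> L * \<bar>a - b\<bar>"
proof -
  obtain K L where "L \<ge> 0" "\<And>x. \<bar>\<psi> x\<bar> \<le> K"
    and L: "\<And>x y. \<bar>\<psi> x - \<psi> y\<bar> \<le> L * L2_set (\<lambda>i. x i - y i) {..<1}"
    using assms by (elim C_bLipE) blast
  moreover have "\<bar>\<psi> (\<lambda>_. a) - \<psi> (\<lambda>_. b)\<bar> \<le> L * \<bar>a - b\<bar>" for a b
    using L[of "\<lambda>_. a" "\<lambda>_. b"] by (simp add: L2_set_def lessThan_Suc)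
  ultimately show ?thesis using that by blast
qed

lemma C_bLip_at:
  assumes "\<psi> \<in> C_bLip 1" "i < n"
  shows "(\<lambda>x. \<psi> (\<lambda>_. x i)) \<in> C_bLip n"
  using assms(1) by (elim C_bLip_1E) (rule C_bLip_coord[OF _ _ assms(2)])

lemma C_bLip_imp_C_lLip:
  assumes "f \<in> C_bLip n"
  shows "f \<in> C_lLip n"
  using assms
proof (rule C_bLipE)
  fix K L assume "K \<ge> 0" "L \<ge> 0" and *: "\<And>x. \<bar>f x\<bar> \<le> K"
    "\<And>x y. \<bar>f x - f y\<bar> \<le> L * L2_set (\<lambda>i. x i - y i) {..<n}"
  have "\<bar>f x - f y\<bar> \<le> (L + 1) * (1 + L2_set x {..<n} ^ 0 + L2_set y {..<n} ^ 0)
      * L2_set (\<lambda>i. x i - y i) {..<n}" for x y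
    using \<open>L \<ge> 0\<close> by (intro order_trans[OF *(2)] mult_right_mono) auto
  then show ?thesis unfolding C_lLip_def using \<open>L \<ge> 0\<close>
    by (intro CollectI exI[of _ "L + 1"] conjI exI[of _ 0]) auto
qed

text \<open>The distance factor in the defining inequality vanishes when the first \<open>n\<close>
  coordinates agree.\<close>

lemma C_lLip_cong:
  assumes "\<phi> \<in> C_lLip n" "\<And>i. i < n \<Longrightarrow> x i = y i"
  shows "\<phi> x = \<phi> y"
proof -
  obtain C m where "\<bar>\<phi> x - \<phi> y\<bar>
      \<le> C * (1 + L2_set x {..<n} ^ m + L2_set y {..<n} ^ m) * L2_set (\<lambda>i. x i - y i) {..<n}"
    using assms(1) unfolding C_lLip_def by blast
  moreover have "L2_set (\<lambda>i. x i - y i) {..<n} = 0"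
    using assms(2) by (subst L2_set_eq_0_iff) auto
  ultimately show ?thesis by simp
qed

lemma C_bLip_cong: "f \<in> C_bLip n \<Longrightarrow> (\<And>i. i < n \<Longrightarrow> x i = y i) \<Longrightarrow> f x = f y"
  by (rule C_lLip_cong[OF C_bLip_imp_C_lLip])

abbreviation clamp1 :: "real \<Rightarrow> real \<Rightarrow> real" where
  "clamp1 c t \<equiv> max (- c) (min c t)"

text \<open>Truncating the arguments bounds the polynomial factor in the local Lipschitz estimate,
  and truncating the value bounds the function. This is how elements of \<open>H_tilde\<close> come
  within reach of bounded Lipschitz functions.\<close>

lemma C_lLip_clamp:
  assumes "\<phi> \<in> C_lLip n" "c \<ge> 0" "R \<ge> 0"
  shows "(\<lambda>x. clamp1 c (\<phi> (\<lambda>i. clamp1 R (x i)))) \<in> C_bLip n"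
proof -
  obtain C m where C: "C > 0" "\<And>x y. \<bar>\<phi> x - \<phi> y\<bar>
      \<le> C * (1 + L2_set x {..<n} ^ m + L2_set y {..<n} ^ m) * L2_set (\<lambda>i. x i - y i) {..<n}"
    using assms(1) unfolding C_lLip_def by auto
  \<comment> \<open>On the cube of half-width \<open>R\<close> the Euclidean norm is at most the sum
    norm, hence at most \<open>real n * R\<close>; \<open>\<kappa>\<close> is the growth factor at
    that radius.\<close>
  define \<kappa> where "\<kappa> = C * (1 + (real n * R) ^ m + (real n * R) ^ m)"
  have \<kappa>: "\<kappa> \<ge> 0" unfolding \<kappa>_def using C assms by auto
  show ?thesis
  proof (rule C_bLipI)
    show "\<bar>clamp1 c (\<phi> (\<lambda>i. clamp1 R (x i)))\<bar> \<le> c" for x using assms by auto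
    fix x y :: "nat \<Rightarrow> real"
    let ?x = "\<lambda>i. clamp1 R (x i)" and ?y = "\<lambda>i. clamp1 R (y i)"
    have bd: "L2_set (\<lambda>i. clamp1 R (z i)) {..<n} \<le> real n * R" for z
    proof -
      have "L2_set (\<lambda>i. clamp1 R (z i)) {..<n} \<le> (\<Sum>i<n. \<bar>clamp1 R (z i)\<bar>)"
        by (rule L2_set_le_sum_abs)
      also have "\<dots> \<le> (\<Sum>i<n. R)" using assms by (intro sum_mono) auto
      finally show ?thesis by simp
    qed
    have "L2_set (\<lambda>i. ?x i - ?y i) {..<n} = L2_set (\<lambda>i. \<bar>?x i - ?y i\<bar>) {..<n}"
      unfolding L2_set_def by simp
    also have "\<dots> \<le> L2_set (\<lambda>i. \<bar>x i - y i\<bar>) {..<n}"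
      by (rule L2_set_mono) auto
    also have "\<dots> = L2_set (\<lambda>i. x i - y i) {..<n}"
      unfolding L2_set_def by simp
    finally have D: "L2_set (\<lambda>i. ?x i - ?y i) {..<n} \<le> L2_set (\<lambda>i. x i - y i) {..<n}" .
    have "\<bar>clamp1 c (\<phi> ?x) - clamp1 c (\<phi> ?y)\<bar> \<le> \<bar>\<phi> ?x - \<phi> ?y\<bar>" by auto
    also have "\<dots> \<le> C * (1 + L2_set ?x {..<n} ^ m + L2_set ?y {..<n} ^ m)
        * L2_set (\<lambda>i. ?x i - ?y i) {..<n}" by (rule C)
    also have "\<dots> \<le> \<kappa> * L2_set (\<lambda>i. x i - y i) {..<n}"
      unfolding \<kappa>_def using C(1) bd D \<kappa>
      by (intro mult_mono add_mono power_mono order_refl) (auto simp: \<kappa>_def)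
    finally show "\<bar>clamp1 c (\<phi> ?x) - clamp1 c (\<phi> ?y)\<bar> \<le> \<kappa> * L2_set (\<lambda>i. x i - y i) {..<n}" .
  qed
qed

section \<open>Sub-linear expectations\<close>

context sublinear_expectation_space
begin

text \<open>Closure under composition asks for at least one argument; the zero function serves as a
  dummy.\<close>

lemma H_const: "(\<lambda>_. c) \<in> H"
  using compose[of 1 "\<lambda>_. c" "\<lambda>_ _. 0"] C_bLip_imp_C_lLip[OF C_bLip_const] zero by simp

lemma H_Lipschitz:
  assumes "Z \<in> H" "\<And>a b. \<bar>h a - h b\<bar> \<le> L * \<bar>a - b\<bar>"
  shows "(\<lambda>\<omega>. h (Z \<omega>)) \<in> H"
proof -
  have "L \<ge> 0" using order_trans[OF abs_ge_zero assms(2)[of 0 1]] by simp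
  \<comment> \<open>With exponent \<open>m = 0\<close> the growth factor is 1 + 1 + 1 = 3;
    \<open>L + 1\<close> is positive even if \<open>L = 0\<close>.\<close>
  have "\<bar>h a - h b\<bar> \<le> (L + 1) * 3 * \<bar>a - b\<bar>" for a b
    using \<open>L \<ge> 0\<close> by (intro order_trans[OF assms(2)] mult_right_mono) auto
  then have "(\<lambda>x. h (x 0)) \<in> C_lLip 1"
    unfolding C_lLip_def using \<open>L \<ge> 0\<close>
    by (intro CollectI exI[of _ "L + 1"] conjI exI[of _ 0]) (auto simp: L2_set_def lessThan_Suc)
  then show ?thesis using compose[of 1 "\<lambda>x. h (x 0)" "\<lambda>_. Z"] assms(1) by simp
qed

lemma H_uminus: "Z \<in> H \<Longrightarrow> (\<lambda>\<omega>. - Z \<omega>) \<in> H"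
  using scale[of Z "-1"] by simp

lemma H_diff: "Y \<in> H \<Longrightarrow> Z \<in> H \<Longrightarrow> (\<lambda>\<omega>. Y \<omega> - Z \<omega>) \<in> H"
  using add[OF _ H_uminus] by simp

lemma H_abs: "Z \<in> H \<Longrightarrow> (\<lambda>\<omega>. \<bar>Z \<omega>\<bar>) \<in> H"
  by (rule H_Lipschitz[of _ _ 1]) auto

lemma H_max: "Z \<in> H \<Longrightarrow> (\<lambda>\<omega>. max c (Z \<omega>)) \<in> H"
  by (rule H_Lipschitz[of _ _ 1]) auto

lemma H_min: "Z \<in> H \<Longrightarrow> (\<lambda>\<omega>. min c (Z \<omega>)) \<in> H"
  by (rule H_Lipschitz[of _ _ 1]) auto

lemma H_sum: "(\<And>j. j \<in> A \<Longrightarrow> Z j \<in> H) \<Longrightarrow> (\<lambda>\<omega>. \<Sum>j\<in>A. Z j \<omega>) \<in> H"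
  by (induction A rule: infinite_finite_induct) (auto intro: zero add)

lemma E_nonneg: "Z \<in> H \<Longrightarrow> (\<And>\<omega>. \<omega> \<in> space M \<Longrightarrow> 0 \<le> Z \<omega>) \<Longrightarrow> 0 \<le> E Z"
  using E_mono[of Z "\<lambda>_. 0"] zero E_const[of 0] by (simp add: zero_ereal_def)

section \<open>Bounded random variables and the finite values of \<open>E\<close> on them\<close>

lemma bddI: "Z \<in> H \<Longrightarrow> (\<And>\<omega>. \<omega> \<in> space M \<Longrightarrow> \<bar>Z \<omega>\<bar> \<le> K) \<Longrightarrow> Z \<in> H_bdd M H"
  unfolding H_bdd_def bounded_iff by auto

lemma bddE:
  assumes "Z \<in> H_bdd M H"
  obtains K where "Z \<in> H" "K \<ge> 0" "\<And>\<omega>. \<omega> \<in> space M \<Longrightarrow> \<bar>Z \<omega>\<bar> \<le> K"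
proof -
  obtain K where "Z \<in> H" "\<And>\<omega>. \<omega> \<in> space M \<Longrightarrow> \<bar>Z \<omega>\<bar> \<le> K"
    using assms unfolding H_bdd_def bounded_iff by auto
  then show ?thesis using that[of "\<bar>K\<bar>"] by fastforce
qed

lemma bdd_H: "Z \<in> H_bdd M H \<Longrightarrow> Z \<in> H"
  unfolding H_bdd_def by simp

lemma bdd_const: "(\<lambda>_. c) \<in> H_bdd M H"
  by (rule bddI[OF H_const order_refl])

lemma bdd_add: "Y \<in> H_bdd M H \<Longrightarrow> Z \<in> H_bdd M H \<Longrightarrow> (\<lambda>\<omega>. Y \<omega> + Z \<omega>) \<in> H_bdd M H"
  by (elim bddE, rule bddI, rule add)
     (auto intro: order_trans[OF abs_triangle_ineq] add_mono)

lemma bdd_scale: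
  assumes "Z \<in> H_bdd M H"
  shows "(\<lambda>\<omega>. a * Z \<omega>) \<in> H_bdd M H"
  using assms
proof (rule bddE)
  fix K assume "Z \<in> H" "\<And>\<omega>. \<omega> \<in> space M \<Longrightarrow> \<bar>Z \<omega>\<bar> \<le> K"
  then show ?thesis
    by (intro bddI[where K="\<bar>a\<bar> * K"] scale) (auto simp: abs_mult intro: mult_left_mono)
qed

lemma bdd_uminus: "Z \<in> H_bdd M H \<Longrightarrow> (\<lambda>\<omega>. - Z \<omega>) \<in> H_bdd M H"
  using bdd_scale[of Z "-1"] by simp

text \<open>Allows real arithmetic on bounded random variables, where \<open>E\<close> is finite. An
  infinite value of \<open>E\<close> would be sent to 0.\<close>

definition Er :: "('a \<Rightarrow> real) \<Rightarrow> real" where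
  "Er Z = real_of_ereal (E Z)"

lemma E_eq_Er:
  assumes "Z \<in> H_bdd M H"
  shows "E Z = ereal (Er Z)"
proof -
  obtain K where K: "Z \<in> H" "\<And>\<omega>. \<omega> \<in> space M \<Longrightarrow> \<bar>Z \<omega>\<bar> \<le> K"
    using assms by (elim bddE) blast
  have "E Z \<le> E (\<lambda>_. K)" "E (\<lambda>_. - K) \<le> E Z"
    using K by (intro E_mono H_const; fastforce)+
  then have "\<bar>E Z\<bar> \<noteq> \<infinity>" unfolding E_const by (cases "E Z") auto
  then show ?thesis unfolding Er_def by (simp add: ereal_real')
qed

lemma Er_mono:
  assumes "Y \<in> H_bdd M H" "Z \<in> H_bdd M H" "\<And>\<omega>. \<omega> \<in> space M \<Longrightarrow> Y \<omega> \<le> Z \<omega>"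
  shows "Er Y \<le> Er Z"
  using E_mono[OF bdd_H bdd_H, of Z Y] assms by (simp add: E_eq_Er)

lemma Er_const: "Er (\<lambda>_. c) = c"
  unfolding Er_def E_const by simp

lemma Er_add_le:
  assumes "Y \<in> H_bdd M H" "Z \<in> H_bdd M H"
  shows "Er (\<lambda>\<omega>. Y \<omega> + Z \<omega>) \<le> Er Y + Er Z"
  using E_subadd[OF bdd_H bdd_H, OF assms] assms by (simp add: E_eq_Er bdd_add)

lemma Er_scale:
  assumes "Z \<in> H_bdd M H" "a \<ge> 0"
  shows "Er (\<lambda>\<omega>. a * Z \<omega>) = a * Er Z"
  using E_scale[OF bdd_H, OF assms] assms(1) by (simp add: E_eq_Er bdd_scale)

text \<open>One inequality is subadditivity; the other is subadditivity applied to
  \<open>- b\<close> and \<open>b + a * Z\<close>.\<close>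

lemma Er_affine:
  assumes Z: "Z \<in> H_bdd M H" and "a \<ge> 0"
  shows "Er (\<lambda>\<omega>. b + a * Z \<omega>) = b + a * Er Z"
proof -
  have aZ: "(\<lambda>\<omega>. a * Z \<omega>) \<in> H_bdd M H" by (rule bdd_scale[OF Z])
  have baZ: "(\<lambda>\<omega>. b + a * Z \<omega>) \<in> H_bdd M H" by (rule bdd_add[OF bdd_const aZ])
  have "Er (\<lambda>\<omega>. b + a * Z \<omega>) \<le> b + a * Er Z"
    using Er_add_le[OF bdd_const aZ, of b] Er_scale[OF assms] Er_const by simp
  moreover have "a * Er Z \<le> - b + Er (\<lambda>\<omega>. b + a * Z \<omega>)"
    using Er_add_le[OF bdd_const baZ, of "- b"] Er_scale[OF assms] Er_const by simp
  ultimately show ?thesis by simp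
qed

text \<open>Subadditivity for \<open>Z + (- Z) = 0\<close>: the lower expectation never exceeds the
  upper one.\<close>

lemma Er_neg_ge: "Z \<in> H_bdd M H \<Longrightarrow> - Er Z \<le> Er (\<lambda>\<omega>. - Z \<omega>)"
  using Er_add_le[OF _ bdd_uminus, of Z Z] Er_const[of 0] by simp

text \<open>Since \<open>- E (- Z)\<close> is the lower expectation, this asks that upper and lower
  expectations coincide and are finite. Linearity of \<open>E\<close> on a set reduces to this
  property of its elements.\<close>

definition mean_certain :: "('a \<Rightarrow> real) \<Rightarrow> bool" where
  "mean_certain Z \<longleftrightarrow> Z \<in> H \<and> \<bar>E Z\<bar> \<noteq> \<infinity> \<and> E (\<lambda>\<omega>. - Z \<omega>) = - E Z"

lemma mean_certain_bdd:
  "Z \<in> H_bdd M H \<Longrightarrow> mean_certain Z \<longleftrightarrow> Er (\<lambda>\<omega>. - Z \<omega>) = - Er Z"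
  unfolding mean_certain_def by (simp add: E_eq_Er bdd_uminus bdd_H)

text \<open>Follows from \<open>Y \<le> Z + \<bar>Y - Z\<bar>\<close>. The last term has finite
  expectation, so subadditivity applies even if \<open>E Z\<close> is infinite.\<close>

lemma E_diff_le:
  assumes "Y \<in> H" "Z \<in> H" "E (\<lambda>\<omega>. \<bar>Y \<omega> - Z \<omega>\<bar>) \<le> ereal \<epsilon>"
  shows "E Y \<le> E Z + ereal \<epsilon>"
proof -
  let ?D = "\<lambda>\<omega>. \<bar>Y \<omega> - Z \<omega>\<bar>"
  have D: "?D \<in> H" using assms by (intro H_abs H_diff)
  have "0 \<le> E ?D" using D by (rule E_nonneg) auto
  with assms(3) have fin: "E ?D \<noteq> \<infinity>" "E ?D \<noteq> - \<infinity>" by auto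
  have "E Y \<le> E (\<lambda>\<omega>. Z \<omega> + ?D \<omega>)"
    using assms D by (intro E_mono add) auto
  also have "\<dots> \<le> E Z + E ?D"
    using assms D fin by (intro E_subadd) auto
  also have "\<dots> \<le> E Z + ereal \<epsilon>" using assms(3) by (rule add_left_mono)
  finally show ?thesis .
qed

text \<open>Certainty of the mean is closed under approximation in the seminorm
  \<open>E \<bar>Y - Z\<bar>\<close>: the upper and lower expectations of \<open>Y\<close> are both
  close to the common value for \<open>Z\<close>.\<close>

lemma mean_certain_approx:
  assumes Y: "Y \<in> H"
    and approx: "\<And>\<epsilon>. \<epsilon> > 0 \<Longrightarrow> \<exists>Z. mean_certain Z \<and> E (\<lambda>\<omega>. \<bar>Y \<omega> - Z \<omega>\<bar>) \<le> ereal \<epsilon>"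
  shows "mean_certain Y"
proof -
  \<comment> \<open>Here \<open>z\<close> is the mean of an approximant. The bounds are written
    additively because \<open>E Y\<close> and \<open>E (- Y)\<close> are not yet known to be finite;
    the case of error 1 then shows that they are.\<close>
  have *: "\<exists>z. E Y \<le> ereal (z + \<epsilon>) \<and> ereal z \<le> E Y + ereal \<epsilon>
      \<and> E (\<lambda>\<omega>. - Y \<omega>) \<le> ereal (\<epsilon> - z) \<and> ereal (- z) \<le> E (\<lambda>\<omega>. - Y \<omega>) + ereal \<epsilon>"
    if \<epsilon>: "\<epsilon> > 0" for \<epsilon>
  proof -
    obtain Z where Z: "mean_certain Z" "E (\<lambda>\<omega>. \<bar>Y \<omega> - Z \<omega>\<bar>) \<le> ereal \<epsilon>"
      using approx[OF \<epsilon>] by blast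
    then obtain z where z: "Z \<in> H" "E Z = ereal z" "E (\<lambda>\<omega>. - Z \<omega>) = ereal (- z)"
      unfolding mean_certain_def by (cases "E Z") auto
    have Z': "E (\<lambda>\<omega>. \<bar>Z \<omega> - Y \<omega>\<bar>) \<le> ereal \<epsilon>"
      "E (\<lambda>\<omega>. \<bar>(- Y \<omega>) - (- Z \<omega>)\<bar>) \<le> ereal \<epsilon>" "E (\<lambda>\<omega>. \<bar>(- Z \<omega>) - (- Y \<omega>)\<bar>) \<le> ereal \<epsilon>"
      using Z(2) by (simp_all add: abs_minus_commute)
    show ?thesis
      using E_diff_le[OF Y z(1) Z(2)] E_diff_le[OF z(1) Y Z'(1)]
        E_diff_le[OF H_uminus[OF Y] H_uminus[OF z(1)] Z'(2)]
        E_diff_le[OF H_uminus[OF z(1)] H_uminus[OF Y] Z'(3)] z(2,3)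
      by (intro exI[of _ z]) (auto simp: algebra_simps)
  qed
  obtain y where y: "E Y = ereal y" using *[of 1] by (cases "E Y") auto
  obtain y' where y': "E (\<lambda>\<omega>. - Y \<omega>) = ereal y'"
    using *[of 1] by (cases "E (\<lambda>\<omega>. - Y \<omega>)") auto
  have "E (\<lambda>\<omega>. Y \<omega> + - Y \<omega>) \<le> E Y + E (\<lambda>\<omega>. - Y \<omega>)"
    using Y H_uminus[OF Y] y y' by (intro E_subadd) auto
  then have "0 \<le> y + y'" using E_const[of 0] y y' by simp
  moreover have "y + y' \<le> 0"
  proof (rule field_le_epsilon)
    fix e :: real assume "e > 0"
    then show "y + y' \<le> 0 + e" using *[of "e / 2"] y y' by force
  qed
  ultimately have "y' = - y" by linarith
  then show ?thesis unfolding mean_certain_def using Y y y' by simp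
qed

text \<open>A negative multiple of \<open>Z\<close> is a positive multiple of \<open>- Z\<close>,
  whose expectation is known.\<close>

lemma mean_certain_scale:
  assumes "mean_certain Z"
  shows "mean_certain (\<lambda>\<omega>. a * Z \<omega>) \<and> E (\<lambda>\<omega>. a * Z \<omega>) = ereal a * E Z"
proof -
  obtain z where z: "Z \<in> H" "E Z = ereal z" "E (\<lambda>\<omega>. - Z \<omega>) = ereal (- z)"
    using assms unfolding mean_certain_def by (cases "E Z") auto
  have *: "E (\<lambda>\<omega>. a * Z \<omega>) = ereal (a * z)" for a
  proof (cases "a \<ge> 0")
    case True
    then show ?thesis using E_scale[OF z(1), of a] z by simp
  next
    case False
    then show ?thesis using E_scale[OF H_uminus[OF z(1)], of "- a"] z by simp
  qed
  show ?thesis unfolding mean_certain_def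
    using *[of a] *[of "- a"] scale[OF z(1)] z(2) by simp
qed

text \<open>The inequality opposite to subadditivity comes from \<open>Y = (Y + Z) + (- Z)\<close>
  and \<open>E (- Z) = - E Z\<close>.\<close>

lemma mean_certain_add:
  assumes "mean_certain Y" "mean_certain Z"
  shows "E (\<lambda>\<omega>. Y \<omega> + Z \<omega>) = E Y + E Z"
proof -
  obtain y where y: "Y \<in> H" "E Y = ereal y"
    using assms unfolding mean_certain_def by (cases "E Y") auto
  obtain z where z: "Z \<in> H" "E Z = ereal z" "E (\<lambda>\<omega>. - Z \<omega>) = ereal (- z)"
    using assms unfolding mean_certain_def by (cases "E Z") auto
  have le: "E (\<lambda>\<omega>. Y \<omega> + Z \<omega>) \<le> E Y + E Z"
    using y z by (intro E_subadd) auto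
  have "E (\<lambda>\<omega>. (Y \<omega> + Z \<omega>) + - Z \<omega>) \<le> E (\<lambda>\<omega>. Y \<omega> + Z \<omega>) + E (\<lambda>\<omega>. - Z \<omega>)"
    using y z H_uminus[OF z(1)] add[OF y(1) z(1)] by (intro E_subadd) auto
  then show ?thesis using le y z by (cases "E (\<lambda>\<omega>. Y \<omega> + Z \<omega>)") auto
qed

lemma linear_expectation_onI:
  assumes "\<And>Y. Y \<in> K \<Longrightarrow> mean_certain Y"
  shows "linear_expectation_on K E"
  unfolding linear_expectation_on_def
proof (intro conjI ballI allI)
  show "\<bar>E Y\<bar> \<noteq> \<infinity>" if "Y \<in> K" for Y
    using assms[OF that] unfolding mean_certain_def by simp
  show "E (\<lambda>\<omega>. a * Y \<omega> + b * Z \<omega>) = ereal a * E Y + ereal b * E Z" if "Y \<in> K" "Z \<in> K" for Y Z a b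
    using mean_certain_scale[OF assms[OF that(1)], of a] mean_certain_scale[OF assms[OF that(2)], of b]
    by (simp add: mean_certain_add)
qed

end

section \<open>Comparison of the capacities\<close>

lemma space_sigma_gen [simp]: "space (sigma_gen M K) = space M"
  unfolding sigma_gen_def by (rule space_measure_of) auto

lemma sets_sigma_gen:
  "sets (sigma_gen M K) = sigma_sets (space M) {f -` B \<inter> space M | f B. f \<in> K \<and> B \<in> sets borel}"
  unfolding sigma_gen_def by (rule sets_measure_of) auto

lemma measurable_sigma_gen:
  assumes "f \<in> K"
  shows "f \<in> borel_measurable (sigma_gen M K)"
proof (rule measurableI)
  fix B :: "real set" assume "B \<in> sets borel"
  then show "f -` B \<inter> space (sigma_gen M K) \<in> sets (sigma_gen M K)"
    unfolding sets_sigma_gen using assms by (auto intro: sigma_sets.Basic)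
qed auto

lemma sigma_gen_mono:
  assumes "K \<subseteq> K'"
  shows "sets (sigma_gen M K) \<subseteq> sets (sigma_gen M K')"
  unfolding sets_sigma_gen by (rule sigma_sets_mono') (use assms in blast)

lemma sigma_gen_le:
  assumes "K \<subseteq> borel_measurable M"
  shows "sets (sigma_gen M K) \<subseteq> sets M"
  unfolding sets_sigma_gen by (rule sets.sigma_sets_subset) (use assms in \<open>auto intro: measurable_sets\<close>)

context sublinear_expectation_space
begin

lemma V_hat_nonneg: "0 \<le> V_hat M H E A"
  unfolding V_hat_def
  by (intro INF_greatest E_nonneg) (auto intro: order_trans[OF indicator_pos_le])

lemma V_hat_le: "g \<in> H \<Longrightarrow> (\<And>\<omega>. \<omega> \<in> space M \<Longrightarrow> indicator A \<omega> \<le> g \<omega>) \<Longrightarrow> V_hat M H E A \<le> E g"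
  unfolding V_hat_def by (rule INF_lower) auto

lemma V_hat_le_1: "V_hat M H E A \<le> 1"
  using V_hat_le[of "\<lambda>_. 1" A] H_const E_const[of 1] by (simp add: indicator_def one_ereal_def)

text \<open>The set \<open>A\<close> followed by empty sets is a measurable cover of
  \<open>A\<close>.\<close>

lemma V_hat_star_le_V_hat:
  assumes "A \<in> sets M"
  shows "V_hat_star M H E A \<le> V_hat M H E A"
proof -
  let ?B = "\<lambda>n::nat. if n = 0 then A else {}"
  have "V_hat M H E {} = 0"
    using V_hat_le[of "\<lambda>_. 0" "{}"] zero E_const[of 0] V_hat_nonneg[of "{}"]
    by (simp add: zero_ereal_def)
  then have "(\<Sum>n. V_hat M H E (?B n)) = V_hat M H E A"
    by (subst suminf_finite[of "{0}"]) auto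
  moreover have "V_hat_star M H E A \<le> (\<Sum>n. V_hat M H E (?B n))"
    unfolding V_hat_star_def by (rule INF_lower) (use assms in \<open>auto split: if_splits\<close>)
  ultimately show ?thesis by simp
qed

text \<open>The summands are nonnegative, so the expectations increase and the \<open>lim\<close> in
  \<open>C_star\<close> is a supremum.\<close>

lemma E_partial_sums:
  assumes "\<And>n. g n \<in> H" "\<And>n \<omega>. \<omega> \<in> space M \<Longrightarrow> 0 \<le> g n \<omega>"
  shows "lim (\<lambda>n. E (\<lambda>\<omega>. \<Sum>i<n. g i \<omega>)) = (SUP n. E (\<lambda>\<omega>. \<Sum>i<n. g i \<omega>))"
proof (rule limI, rule LIMSEQ_SUP)
  show "incseq (\<lambda>n. E (\<lambda>\<omega>. \<Sum>i<n. g i \<omega>))"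
    by (rule incseq_SucI, rule E_mono)
       (use assms H_sum[of _ g] in \<open>auto simp del: sum.lessThan_Suc intro!: sum_mono2\<close>)
qed

lemma E_sum_le:
  fixes n :: nat
  assumes "\<And>n. g n \<in> H" "\<And>n \<omega>. \<omega> \<in> space M \<Longrightarrow> 0 \<le> g n \<omega>"
  shows "E (\<lambda>\<omega>. \<Sum>i<n. g i \<omega>) \<le> (\<Sum>i<n. E (g i))"
proof (induction n)
  case 0
  then show ?case using E_const[of 0] by simp
next
  case (Suc n)
  have "0 \<le> E (\<lambda>\<omega>. \<Sum>i<n. g i \<omega>)" "0 \<le> E (g n)"
    using assms by (auto intro!: E_nonneg H_sum sum_nonneg)
  then have "E (\<lambda>\<omega>. (\<Sum>i<n. g i \<omega>) + g n \<omega>) \<le> E (\<lambda>\<omega>. \<Sum>i<n. g i \<omega>) + E (g n)"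
    using assms by (intro E_subadd H_sum) auto
  also have "\<dots> \<le> (\<Sum>i<n. E (g i)) + E (g n)" by (rule add_right_mono[OF Suc.IH])
  finally show ?case by simp
qed

text \<open>Given a cover \<open>B\<close>, nearly optimal majorants \<open>\<xi> n\<close> of the
  indicators of the \<open>B n\<close> form a series that competes in \<open>C_star\<close>: a point
  of \<open>A\<close> lies in some \<open>B n\<close>, where \<open>\<xi> n\<close> is already at
  least 1. The excess is distributed geometrically over \<open>n\<close>.\<close>

lemma C_star_le_V_hat_star: "C_star M H E A \<le> V_hat_star M H E A"
  unfolding V_hat_star_def
proof (rule INF_greatest, rule ereal_le_epsilon2)
  fix B :: "nat \<Rightarrow> 'a set" and e :: real
  assume "B \<in> {B. range B \<subseteq> sets M \<and> A \<subseteq> (\<Union>n. B n)}" and "0 < e"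
  then have A: "A \<subseteq> (\<Union>n. B n)" by blast
  let ?V = "V_hat M H E"
  have "\<exists>\<xi>\<in>H. (\<forall>\<omega>\<in>space M. indicator (B n) \<omega> \<le> \<xi> \<omega>) \<and> E \<xi> \<le> ?V (B n) + ereal (e * (1/2) ^ Suc n)" for n
  proof -
    \<comment> \<open>Finiteness makes the added slack a strict increase, so the infimum yields a
      majorant.\<close>
    have "\<bar>?V (B n)\<bar> \<noteq> \<infinity>"
      using V_hat_nonneg[of "B n"] V_hat_le_1[of "B n"] by (cases "?V (B n)") auto
    then have "?V (B n) < ?V (B n) + ereal (e * (1/2) ^ Suc n)"
      using \<open>0 < e\<close> by (cases "?V (B n)") auto
    then show ?thesis
      by (subst (asm) V_hat_def) (fastforce simp: INF_less_iff intro: less_imp_le)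
  qed
  then obtain \<xi> where \<xi>: "\<And>n. \<xi> n \<in> H" "\<And>n \<omega>. \<omega> \<in> space M \<Longrightarrow> indicator (B n) \<omega> \<le> \<xi> n \<omega>"
    and E\<xi>: "\<And>n. E (\<xi> n) \<le> ?V (B n) + ereal (e * (1/2) ^ Suc n)"
    by metis
  have \<xi>0: "0 \<le> \<xi> n \<omega>" if "\<omega> \<in> space M" for n \<omega>
    using \<xi>(2)[OF that] by (rule order_trans[OF indicator_pos_le])
  have "C_star M H E A \<le> lim (\<lambda>n. E (\<lambda>\<omega>. \<Sum>i<n. \<xi> i \<omega>))"
    unfolding C_star_def
  proof (rule INF_lower, intro CollectI conjI ballI allI \<xi> \<xi>0)
    fix \<omega> assume \<omega>: "\<omega> \<in> space M"
    have nn: "0 \<le> ereal (\<xi> n \<omega>)" for n using \<xi>0[OF \<omega>] by simp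
    show "indicator A \<omega> \<le> (\<Sum>n. ereal (\<xi> n \<omega>))"
    proof (cases "\<omega> \<in> A")
      case True
      then obtain n where "\<omega> \<in> B n" using A by blast
      then have "1 \<le> \<xi> n \<omega>" using \<xi>(2)[OF \<omega>, of n] by simp
      also have "\<dots> \<le> (\<Sum>i<Suc n. \<xi> i \<omega>)" using \<xi>0[OF \<omega>] by (simp add: sum_nonneg)
      finally have "1 \<le> (\<Sum>i<Suc n. ereal (\<xi> i \<omega>))" by (simp add: one_ereal_def)
      also have "\<dots> \<le> (\<Sum>n. ereal (\<xi> n \<omega>))" by (rule suminf_upper[OF nn])
      finally show ?thesis using True by simp
    next
      case False
      have "0 \<le> (\<Sum>n. ereal (\<xi> n \<omega>))" by (rule suminf_nonneg[OF summable_ereal_pos nn]) (rule nn)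
      then show ?thesis using False by simp
    qed
  qed
  also have "\<dots> = (SUP n. E (\<lambda>\<omega>. \<Sum>i<n. \<xi> i \<omega>))"
    by (rule E_partial_sums[OF \<xi>(1) \<xi>0])
  also have "\<dots> \<le> (\<Sum>n. ?V (B n)) + ereal e"
  proof (rule SUP_least)
    fix n :: nat
    have "E (\<lambda>\<omega>. \<Sum>i<n. \<xi> i \<omega>) \<le> (\<Sum>i<n. E (\<xi> i))" by (rule E_sum_le[OF \<xi>(1) \<xi>0])
    also have "\<dots> \<le> (\<Sum>i<n. ?V (B i) + ereal (e * (1/2) ^ Suc i))" by (intro sum_mono E\<xi>)
    also have "\<dots> = (\<Sum>i<n. ?V (B i)) + ereal (\<Sum>i<n. e * (1/2) ^ Suc i)"
      by (simp add: sum.distrib)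
    also have "\<dots> \<le> (\<Sum>n. ?V (B n)) + ereal e"
    proof (intro add_mono suminf_upper V_hat_nonneg)
      have "(\<Sum>i<n. e * (1/2) ^ Suc i) = e * (1 - (1/2) ^ n)"
        by (induction n) (auto simp: algebra_simps)
      also have "\<dots> \<le> e" using \<open>0 < e\<close> by (simp add: mult_le_cancel_left1)
      finally show "ereal (\<Sum>i<n. e * (1/2) ^ Suc i) \<le> ereal e" by simp
    qed
    finally show "E (\<lambda>\<omega>. \<Sum>i<n. \<xi> i \<omega>) \<le> (\<Sum>n. ?V (B n)) + ereal e" .
  qed
  finally show "C_star M H E A \<le> (\<Sum>n. ?V (B n)) + ereal e" .
qed

end

section \<open>Bounds from the representing family of probability measures\<close>

locale CC_space = sublinear_expectation_space M H E
  for M :: "'a measure" and H :: "('a \<Rightarrow> real) set" and E :: "('a \<Rightarrow> real) \<Rightarrow> ereal" +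
  fixes \<P> :: "'a measure set"
  assumes CC: "condition_CC M H E \<P>"
begin

lemma P_prob: "P \<in> \<P> \<Longrightarrow> prob_space P"
  and P_sets: "P \<in> \<P> \<Longrightarrow> sets P = sets (sigma_gen M H)"
  and P_sup: "Z \<in> H_bdd M H \<Longrightarrow> E Z = (SUP P\<in>\<P>. ereal (\<integral>\<omega>. Z \<omega> \<partial>P))"
  using CC unfolding condition_CC_def by auto

lemma P_space: "P \<in> \<P> \<Longrightarrow> space P = space M"
  using sets_eq_imp_space_eq[OF P_sets] by simp

lemma P_measurable: "P \<in> \<P> \<Longrightarrow> borel_measurable P = borel_measurable (sigma_gen M H)"
  by (rule measurable_cong_sets[OF P_sets refl])

lemma P_integrable:
  fixes K :: real
  assumes "P \<in> \<P>" "f \<in> borel_measurable (sigma_gen M H)" "\<And>\<omega>. \<omega> \<in> space M \<Longrightarrow> \<bar>f \<omega>\<bar> \<le> K"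
  shows "integrable P f"
proof -
  interpret prob_space P by (rule P_prob[OF assms(1)])
  show ?thesis
    using assms by (intro integrable_const_bound[of _ K]) (auto simp: P_space P_measurable)
qed

lemma P_integrable_bdd:
  assumes "P \<in> \<P>" "Z \<in> H_bdd M H"
  shows "integrable P Z"
  using assms(2) by (elim bddE, intro P_integrable[OF assms(1)] measurable_sigma_gen) auto

lemma integral_le_Er:
  assumes "P \<in> \<P>" "Z \<in> H_bdd M H"
  shows "(\<integral>\<omega>. Z \<omega> \<partial>P) \<le> Er Z"
proof -
  have "ereal (\<integral>\<omega>. Z \<omega> \<partial>P) \<le> E Z"
    unfolding P_sup[OF assms(2)] by (rule SUP_upper[OF assms(1)])
  then show ?thesis by (simp add: E_eq_Er[OF assms(2)])
qed

lemma less_Er: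
  assumes "Z \<in> H_bdd M H" "c < Er Z"
  obtains P where "P \<in> \<P>" "c < (\<integral>\<omega>. Z \<omega> \<partial>P)"
proof -
  have "ereal c < E Z" using assms(2) E_eq_Er[OF assms(1)] by simp
  then show ?thesis using that unfolding P_sup[OF assms(1)] by (auto simp: less_SUP_iff)
qed

text \<open>For a competitor \<open>g\<close> with partial sums \<open>G n\<close>, the functions
  \<open>min f (G n)\<close> increase to \<open>f\<close>, because the full series dominates the
  indicator of \<open>A\<close> and hence \<open>f\<close>. Each integral is at most
  \<open>E (G n)\<close>, and dominated convergence concludes. Both indicators and bounded elements
  of \<open>H\<close> can take the place of \<open>f\<close>.\<close>

lemma integral_le_C_star:
  assumes P: "P \<in> \<P>" and f: "f \<in> borel_measurable (sigma_gen M H)"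
    and f01: "\<And>\<omega>. \<omega> \<in> space M \<Longrightarrow> 0 \<le> f \<omega>" "\<And>\<omega>. \<omega> \<in> space M \<Longrightarrow> f \<omega> \<le> indicator A \<omega>"
  shows "ereal (\<integral>\<omega>. f \<omega> \<partial>P) \<le> C_star M H E A"
  unfolding C_star_def
proof (rule INF_greatest)
  interpret prob_space P by (rule P_prob[OF P])
  fix g :: "nat \<Rightarrow> 'a \<Rightarrow> real"
  assume "g \<in> {g. (\<forall>n. g n \<in> H) \<and> (\<forall>n. \<forall>\<omega>\<in>space M. 0 \<le> g n \<omega>) \<and>
                (\<forall>\<omega>\<in>space M. indicator A \<omega> \<le> (\<Sum>n. ereal (g n \<omega>)))}"
  then have gH: "\<And>n. g n \<in> H" and g0: "\<And>n \<omega>. \<omega> \<in> space M \<Longrightarrow> 0 \<le> g n \<omega>"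
    and cover: "\<And>\<omega>. \<omega> \<in> space M \<Longrightarrow> indicator A \<omega> \<le> (\<Sum>n. ereal (g n \<omega>))" by auto
  define G where "G n \<omega> = (\<Sum>i<n. g i \<omega>)" for n \<omega>
  have GH: "G n \<in> H" for n
    using H_sum[of "{..<n}" g] gH unfolding G_def[abs_def] by simp
  have G0: "0 \<le> G n \<omega>" if "\<omega> \<in> space M" for n \<omega>
    unfolding G_def using g0[OF that] by (simp add: sum_nonneg)
  have f1: "f \<omega> \<le> 1" if "\<omega> \<in> space M" for \<omega>
    using f01(2)[OF that] by (rule order_trans[OF _ indicator_le_1])
  have min1: "\<bar>min (f \<omega>) (G n \<omega>)\<bar> \<le> 1" if "\<omega> \<in> space M" for n \<omega>
    using G0[OF that, of n] f01(1)[OF that] f1[OF that] by simp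
  have meas: "(\<lambda>\<omega>. min (f \<omega>) (G n \<omega>)) \<in> borel_measurable (sigma_gen M H)" for n
    using f measurable_sigma_gen[OF GH] by measurable
  have lim: "(\<lambda>n. min (f \<omega>) (G n \<omega>)) \<longlonglongrightarrow> f \<omega>" if \<omega>: "\<omega> \<in> space M" for \<omega>
  proof (rule increasing_tendsto)
    show "\<forall>\<^sub>F n in sequentially. min (f \<omega>) (G n \<omega>) \<le> f \<omega>" by simp
    fix x assume x: "x < f \<omega>"
    have "ereal x < ereal (f \<omega>)" using x by simp
    also have "\<dots> \<le> ereal (indicator A \<omega>)" using f01(2)[OF \<omega>] by simp
    also have "\<dots> = indicator A \<omega>" by (simp add: indicator_def)
    also have "\<dots> \<le> (\<Sum>n. ereal (g n \<omega>))" by (rule cover[OF \<omega>])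
    also have "\<dots> = (SUP n. \<Sum>i<n. ereal (g i \<omega>))"
      by (rule suminf_ereal_eq_SUP) (simp add: g0[OF \<omega>])
    finally have "ereal x < (SUP n. \<Sum>i<n. ereal (g i \<omega>))" .
    then obtain n where "ereal x < (\<Sum>i<n. ereal (g i \<omega>))" unfolding less_SUP_iff by blast
    then have n: "x < G n \<omega>" by (simp add: G_def)
    have "x < min (f \<omega>) (G m \<omega>)" if "n \<le> m" for m
    proof -
      have "G n \<omega> \<le> G m \<omega>"
        unfolding G_def using that g0[OF \<omega>] by (intro sum_mono2) auto
      then show ?thesis using x n by simp
    qed
    then show "\<forall>\<^sub>F n in sequentially. x < min (f \<omega>) (G n \<omega>)"
      unfolding eventually_sequentially by blast
  qed
  have conv: "(\<lambda>n. \<integral>\<omega>. min (f \<omega>) (G n \<omega>) \<partial>P) \<longlonglongrightarrow> (\<integral>\<omega>. f \<omega> \<partial>P)"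
  proof (rule integral_dominated_convergence[where w="\<lambda>_. 1"])
    show "AE \<omega> in P. (\<lambda>n. min (f \<omega>) (G n \<omega>)) \<longlonglongrightarrow> f \<omega>"
      using lim by (auto simp: P_space[OF P])
    show "AE \<omega> in P. norm (min (f \<omega>) (G n \<omega>)) \<le> 1" for n
      using min1 by (intro AE_I2) (simp add: P_space[OF P])
  qed (use f meas P_measurable[OF P] in auto)
  have le: "ereal (\<integral>\<omega>. min (f \<omega>) (G n \<omega>) \<partial>P) \<le> (SUP n. E (G n))" for n
  proof -
    \<comment> \<open>The representation of \<open>E\<close> is available for bounded functions
      only, so the partial sum is capped at 1, which still dominates \<open>f\<close>.\<close>
    have mG: "(\<lambda>\<omega>. min 1 (G n \<omega>)) \<in> H_bdd M H"
      using G0 by (intro bddI[of _ 1] H_min GH) auto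
    have "(\<integral>\<omega>. min (f \<omega>) (G n \<omega>) \<partial>P) \<le> (\<integral>\<omega>. min 1 (G n \<omega>) \<partial>P)"
    proof (rule integral_mono)
      show "integrable P (\<lambda>\<omega>. min (f \<omega>) (G n \<omega>))"
        by (rule P_integrable[OF P meas min1])
      show "integrable P (\<lambda>\<omega>. min 1 (G n \<omega>))" by (rule P_integrable_bdd[OF P mG])
      show "min (f \<omega>) (G n \<omega>) \<le> min 1 (G n \<omega>)" if "\<omega> \<in> space P" for \<omega>
        using f1[of \<omega>] that by (simp add: P_space[OF P] min.coboundedI1)
    qed
    also have "\<dots> \<le> Er (\<lambda>\<omega>. min 1 (G n \<omega>))" by (rule integral_le_Er[OF P mG])
    finally have "ereal (\<integral>\<omega>. min (f \<omega>) (G n \<omega>) \<partial>P) \<le> E (\<lambda>\<omega>. min 1 (G n \<omega>))"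
      by (simp add: E_eq_Er[OF mG])
    also have "\<dots> \<le> E (G n)" by (intro E_mono GH bdd_H[OF mG]) auto
    also have "\<dots> \<le> (SUP n. E (G n))" by (rule SUP_upper) simp
    finally show ?thesis .
  qed
  have "ereal (\<integral>\<omega>. f \<omega> \<partial>P) \<le> (SUP n. E (G n))"
    by (rule LIMSEQ_le_const2[OF tendsto_ereal[OF conv]]) (use le in blast)
  then show "ereal (\<integral>\<omega>. f \<omega> \<partial>P) \<le> lim (\<lambda>n. E (\<lambda>\<omega>. \<Sum>i<n. g i \<omega>))"
    using E_partial_sums[OF gH g0] unfolding G_def[abs_def] by simp
qed

text \<open>The positive part of \<open>f\<close> still lies below the indicator and takes values in
  [0, 1], so \<open>E\<close> of it is a supremum of integrals, each controlled by
  \<open>C_star\<close>.\<close>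

lemma E_le_C_star:
  assumes "f \<in> H" "\<And>\<omega>. \<omega> \<in> space M \<Longrightarrow> f \<omega> \<le> indicator A \<omega>"
  shows "E f \<le> C_star M H E A"
proof -
  have "max 0 (f \<omega>) \<le> indicator A \<omega>" if "\<omega> \<in> space M" for \<omega>
    using assms(2)[OF that] by simp
  note le = this order_trans[OF this indicator_le_1]
  have f: "(\<lambda>\<omega>. max 0 (f \<omega>)) \<in> H_bdd M H"
    using le by (intro bddI[of _ 1] H_max assms) auto
  have "E f \<le> E (\<lambda>\<omega>. max 0 (f \<omega>))" by (intro E_mono bdd_H[OF f] assms) auto
  also have "\<dots> \<le> C_star M H E A"
    unfolding P_sup[OF f]
    using le by (intro SUP_least integral_le_C_star measurable_sigma_gen bdd_H[OF f]) auto
  finally show ?thesis .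
qed

lemma V_fam_le_C_star:
  assumes "A \<in> sets (sigma_gen M H)"
  shows "V_fam \<P> A \<le> C_star M H E A"
  unfolding V_fam_def
proof (rule SUP_least)
  fix P assume P: "P \<in> \<P>"
  have "ereal (\<integral>\<omega>. indicator A \<omega> \<partial>P) \<le> C_star M H E A"
    using P assms by (intro integral_le_C_star) auto
  moreover have "A \<subseteq> space P" using sets.sets_into_space[OF assms] by (simp add: P_space[OF P])
  ultimately show "ereal (measure P A) \<le> C_star M H E A" by (simp add: Int_absorb2)
qed

text \<open>The positive part of \<open>f\<close> is bounded, and its integral under each
  \<open>P\<close> is at most \<open>P A\<close>.\<close>

lemma E_le_V_fam:
  assumes A: "A \<in> sets (sigma_gen M H)" and f: "f \<in> H" "\<And>\<omega>. \<omega> \<in> space M \<Longrightarrow> f \<omega> \<le> indicator A \<omega>"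
  shows "E f \<le> V_fam \<P> A"
proof -
  have le: "max 0 (f \<omega>) \<le> indicator A \<omega>" if "\<omega> \<in> space M" for \<omega>
    using f(2)[OF that] by simp
  have g: "(\<lambda>\<omega>. max 0 (f \<omega>)) \<in> H_bdd M H"
    using order_trans[OF le indicator_le_1] by (intro bddI[of _ 1] H_max f) auto
  have "E f \<le> E (\<lambda>\<omega>. max 0 (f \<omega>))" by (intro E_mono bdd_H[OF g] f) auto
  also have "\<dots> \<le> V_fam \<P> A"
    unfolding P_sup[OF g] V_fam_def
  proof (rule SUP_subset_mono[OF order_refl])
    fix P assume P: "P \<in> \<P>"
    have "(\<integral>\<omega>. max 0 (f \<omega>) \<partial>P) \<le> (\<integral>\<omega>. indicator A \<omega> \<partial>P)"
      using le A by (intro integral_mono P_integrable_bdd[OF P g] P_integrable[OF P, of _ 1])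
        (auto simp: P_space[OF P])
    moreover have "A \<subseteq> space P" using sets.sets_into_space[OF A] by (simp add: P_space[OF P])
    ultimately show "ereal (\<integral>\<omega>. max 0 (f \<omega>) \<partial>P) \<le> ereal (measure P A)"
      by (simp add: Int_absorb2)
  qed
  finally show ?thesis .
qed

text \<open>Collects what the linearity argument asks of a capacity, so that it is carried out once
  for all four.\<close>

definition admissible :: "('a set \<Rightarrow> ereal) \<Rightarrow> 'a set set \<Rightarrow> bool" where
  "admissible V \<A> \<longleftrightarrow> sets (sigma_gen M H) \<subseteq> \<A> \<and>
     (\<forall>A\<in>sets (sigma_gen M H). V_fam \<P> A \<le> V A) \<and> sandwich_property M H E V \<A>"

text \<open>On the sigma-algebra of \<open>H\<close> the capacities are ordered as
  \<open>V_fam\<close>, \<open>C_star\<close>, \<open>V_hat_star\<close>, \<open>V_hat\<close>.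
  Lower bounds by \<open>E f\<close> are proved for the first two and passed upwards; the upper
  bound by \<open>E g\<close> is immediate for \<open>V_hat\<close> and is passed downwards.\<close>

lemma admissible_capacities:
  "\<forall>(V, \<A>) \<in> {(V_fam \<P>, sets (sigma_gen M H)), (C_star M H E, sets M),
      (V_hat_star M H E, sets M), (V_hat M H E, sets M)}. admissible V \<A>"
proof -
  have sub: "sets (sigma_gen M H) \<subseteq> sets M"
    using measurable by (intro sigma_gen_le) auto
  have C_le: "C_star M H E A \<le> V_hat_star M H E A" for A by (rule C_star_le_V_hat_star)
  have star_le: "V_hat_star M H E A \<le> V_hat M H E A" if "A \<in> sets M" for A
    by (rule V_hat_star_le_V_hat[OF that])
  have lower: "V_fam \<P> A \<le> C_star M H E A" if "A \<in> sets (sigma_gen M H)" for A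
    by (rule V_fam_le_C_star[OF that])
  have sandwich: "sandwich_property M H E V \<A>"
    if "\<And>A f. A \<in> \<A> \<Longrightarrow> f \<in> H \<Longrightarrow> (\<And>\<omega>. \<omega> \<in> space M \<Longrightarrow> f \<omega> \<le> indicator A \<omega>) \<Longrightarrow> E f \<le> V A"
      and "\<And>A. A \<in> \<A> \<Longrightarrow> V A \<le> V_hat M H E A" for V \<A>
    unfolding sandwich_property_def using that by (blast intro: order_trans V_hat_le)
  have "admissible (V_fam \<P>) (sets (sigma_gen M H))"
    unfolding admissible_def
  proof (intro conjI ballI sandwich order_refl)
    show "V_fam \<P> A \<le> V_hat M H E A" if "A \<in> sets (sigma_gen M H)" for A
      using lower[OF that] C_le[of A] star_le[of A] that sub by (blast intro: order_trans)
  qed (auto intro: E_le_V_fam)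
  moreover have "admissible (C_star M H E) (sets M)"
    unfolding admissible_def
  proof (intro conjI ballI sandwich sub lower)
    show "C_star M H E A \<le> V_hat M H E A" if "A \<in> sets M" for A
      using C_le[of A] star_le[OF that] by (rule order_trans)
  qed (auto intro: E_le_C_star)
  moreover have "admissible (V_hat_star M H E) (sets M)"
    unfolding admissible_def
  proof (intro conjI ballI sandwich sub star_le)
    show "V_fam \<P> A \<le> V_hat_star M H E A" if "A \<in> sets (sigma_gen M H)" for A
      using lower[OF that] C_le by (rule order_trans)
    show "E f \<le> V_hat_star M H E A" if "f \<in> H" "\<And>\<omega>. \<omega> \<in> space M \<Longrightarrow> f \<omega> \<le> indicator A \<omega>" for A f
      using E_le_C_star[OF that] C_le by (rule order_trans)
  qed
  moreover have "admissible (V_hat M H E) (sets M)"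
    unfolding admissible_def
  proof (intro conjI ballI sandwich sub order_refl)
    show "V_fam \<P> A \<le> V_hat M H E A" if "A \<in> sets (sigma_gen M H)" for A
      using lower[OF that] C_le[of A] star_le[of A] that sub by (blast intro: order_trans)
    show "E f \<le> V_hat M H E A"
      if "A \<in> sets M" "f \<in> H" "\<And>\<omega>. \<omega> \<in> space M \<Longrightarrow> f \<omega> \<le> indicator A \<omega>" for A f
      using E_le_C_star[OF that(2,3)] C_le[of A] star_le[OF that(1)] by (blast intro: order_trans)
  qed
  ultimately show ?thesis by simp
qed

end

section \<open>Continuity along decreasing sequences\<close>

context CC_space
begin

text \<open>Take \<open>Q d\<close> with integral of \<open>g d\<close> above \<open>c\<close> and a
  limit \<open>P\<close> along a subsequence. Monotonicity gives each fixed \<open>g d\<close> an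
  integral above \<open>c\<close> under all later \<open>Q (r k)\<close>, and this survives the
  limit as a weak inequality. A single \<open>P\<close> thus serves all \<open>d\<close>.\<close>

lemma CC_decreasing:
  fixes g :: "nat \<Rightarrow> 'a \<Rightarrow> real"
  assumes g: "\<And>d. g d \<in> H_bdd M H"
    and dec: "\<And>d e \<omega>. d \<le> e \<Longrightarrow> \<omega> \<in> space M \<Longrightarrow> g e \<omega> \<le> g d \<omega>"
    and less: "\<And>d. c < Er (g d)"
  obtains P where "P \<in> \<P>" "\<And>d. c \<le> (\<integral>\<omega>. g d \<omega> \<partial>P)"
proof -
  have "\<exists>Q\<in>\<P>. c < (\<integral>\<omega>. g d \<omega> \<partial>Q)" for d
    using less_Er[OF g less] by metis
  then obtain Q where Q: "\<And>d. Q d \<in> \<P>" "\<And>d. c < (\<integral>\<omega>. g d \<omega> \<partial>(Q d))" by metis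
  have "ctbl_dim_weakly_compact M H \<P>" using CC unfolding condition_CC_def by blast
  then obtain r P where r: "strict_mono (r :: nat \<Rightarrow> nat)" and P: "P \<in> \<P>"
    and conv: "\<And>d \<phi>. d \<ge> 1 \<Longrightarrow> \<phi> \<in> C_bLip d \<Longrightarrow>
      (\<lambda>k. \<integral>\<omega>. \<phi> (\<lambda>i. g i \<omega>) \<partial>(Q (r k))) \<longlonglongrightarrow> (\<integral>\<omega>. \<phi> (\<lambda>i. g i \<omega>) \<partial>P)"
    unfolding ctbl_dim_weakly_compact_def using g Q(1) by (metis image_subsetI)
  have "c \<le> (\<integral>\<omega>. g d \<omega> \<partial>P)" for d
  proof -
    obtain K where K: "K \<ge> 0" "\<And>\<omega>. \<omega> \<in> space M \<Longrightarrow> \<bar>g d \<omega>\<bar> \<le> K"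
      using g[of d] by (elim bddE) blast
    have clamp: "clamp1 K (g d \<omega>) = g d \<omega>" if "\<omega> \<in> space M" for \<omega>
      using K(2)[OF that] by (auto simp: abs_le_iff)
    have eq: "(\<integral>\<omega>. clamp1 K (g d \<omega>) \<partial>R) = (\<integral>\<omega>. g d \<omega> \<partial>R)" if "R \<in> \<P>" for R
      using clamp by (intro Bochner_Integration.integral_cong) (auto simp: P_space[OF that])
    \<comment> \<open>The compactness condition tests bounded Lipschitz functions only. The
      coordinate projection is therefore clamped at a bound of \<open>g d\<close>, which leaves its
      values unchanged; coordinate \<open>d\<close> requires dimension \<open>Suc d\<close>.\<close>
    have "(\<lambda>x. clamp1 K (x d)) \<in> C_bLip (Suc d)"
      by (rule C_bLip_coord[where K=K and L=1]) (use K(1) in auto)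
    from conv[OF _ this] have lim: "(\<lambda>k. \<integral>\<omega>. g d \<omega> \<partial>(Q (r k))) \<longlonglongrightarrow> (\<integral>\<omega>. g d \<omega> \<partial>P)"
      by (simp add: eq P Q(1))
    have "c \<le> (\<integral>\<omega>. g d \<omega> \<partial>(Q (r k)))" if "d \<le> k" for k
    proof -
      have "d \<le> r k" using seq_suble[OF r, of k] that by linarith
      then have "(\<integral>\<omega>. g (r k) \<omega> \<partial>(Q (r k))) \<le> (\<integral>\<omega>. g d \<omega> \<partial>(Q (r k)))"
        using dec by (intro integral_mono P_integrable_bdd Q g) (auto simp: P_space[OF Q(1)])
      then show ?thesis using Q(2)[of "r k"] by linarith
    qed
    then show ?thesis using LIMSEQ_le_const[OF lim] by blast
  qed
  then show ?thesis using P that by blast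
qed

text \<open>Otherwise one \<open>P\<close> would keep all integrals at least \<epsilon>, against
  dominated convergence.\<close>

lemma Er_decreasing_to_0:
  fixes g :: "nat \<Rightarrow> 'a \<Rightarrow> real"
  assumes g: "\<And>d. g d \<in> H_bdd M H"
    and dec: "\<And>d e \<omega>. d \<le> e \<Longrightarrow> \<omega> \<in> space M \<Longrightarrow> g e \<omega> \<le> g d \<omega>"
    and nonneg: "\<And>d \<omega>. \<omega> \<in> space M \<Longrightarrow> 0 \<le> g d \<omega>"
    and lim: "\<And>\<omega>. \<omega> \<in> space M \<Longrightarrow> (\<lambda>d. g d \<omega>) \<longlonglongrightarrow> 0"
    and "\<epsilon> > 0"
  shows "\<exists>d. Er (g d) \<le> \<epsilon>"
proof (rule ccontr)
  assume "\<not> ?thesis"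
  then have "\<epsilon> < Er (g d)" for d by (simp add: not_le)
  from CC_decreasing[of g, OF g dec this]
  obtain P where P: "P \<in> \<P>" "\<And>d. \<epsilon> \<le> (\<integral>\<omega>. g d \<omega> \<partial>P)" by blast
  have "(\<lambda>d. \<integral>\<omega>. g d \<omega> \<partial>P) \<longlonglongrightarrow> (\<integral>\<omega>. 0 \<partial>P)"
  proof (rule integral_dominated_convergence[where w="g 0"])
    show "AE \<omega> in P. (\<lambda>d. g d \<omega>) \<longlonglongrightarrow> 0" using lim by (auto simp: P_space[OF P(1)])
    show "AE \<omega> in P. norm (g d \<omega>) \<le> g 0 \<omega>" for d
      using nonneg dec by (auto simp: P_space[OF P(1)])
  qed (auto intro: P_integrable_bdd[OF P(1) g] borel_measurable_integrable)
  then have "\<epsilon> \<le> 0" using LIMSEQ_le_const P(2) by fastforce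
  then show False using \<open>\<epsilon> > 0\<close> by simp
qed

end

section \<open>Independent identically distributed sequences\<close>

text \<open>Used in two cases: for \<open>a = b\<close> it is the distance in the first
  \<open>n\<close> coordinates, for \<open>x = y\<close> it is
  \<open>\<bar>a - b\<bar>\<close>.\<close>

lemma L2_set_fun_upd_last: "L2_set (\<lambda>i. (x(n := a)) i - (y(n := b)) i) {..<Suc n}
    = sqrt ((L2_set (\<lambda>i. x i - y i) {..<n})\<^sup>2 + (a - b)\<^sup>2)"
  unfolding L2_set_def by (simp add: sum_nonneg)

locale iid_CC_space = CC_space M H E \<P>
  for M :: "'a measure" and H :: "('a \<Rightarrow> real) set" and E :: "('a \<Rightarrow> real) \<Rightarrow> ereal"
    and \<P> :: "'a measure set" +
  fixes X :: "nat \<Rightarrow> 'a \<Rightarrow> real"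
  assumes X_H: "X n \<in> H"
    and indep: "indep_seq H E X"
    and ident: "ident_distr_seq E X"
begin

section \<open>Bounded Lipschitz functions of the sequence\<close>

lemma bdd_X:
  assumes "\<phi> \<in> C_bLip n"
  shows "(\<lambda>\<omega>. \<phi> (\<lambda>i. X i \<omega>)) \<in> H_bdd M H"
proof -
  have \<phi>: "\<phi> \<in> C_bLip (Suc n)" using C_bLip_mono[OF _ assms] by simp
  obtain K where "\<And>x. \<bar>\<phi> x\<bar> \<le> K" using assms by (elim C_bLipE) blast
  then show ?thesis
    using compose[of "Suc n" \<phi> X] C_bLip_imp_C_lLip[OF \<phi>] X_H by (intro bddI[of _ K]) auto
qed

lemma bdd_X1:
  assumes "\<psi> \<in> C_bLip 1"
  shows "(\<lambda>\<omega>. \<psi> (\<lambda>_. X k \<omega>)) \<in> H_bdd M H"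
  using bdd_X[OF C_bLip_at[OF assms lessI[of k]]] by simp

lemma Er_X1:
  assumes "\<psi> \<in> C_bLip 1"
  shows "Er (\<lambda>\<omega>. \<psi> (\<lambda>_. X k \<omega>)) = Er (\<lambda>\<omega>. \<psi> (\<lambda>_. X 0 \<omega>))"
proof -
  have "E (\<lambda>\<omega>. \<psi> (\<lambda>_. X k \<omega>)) = E (\<lambda>\<omega>. \<psi> (\<lambda>_. X 0 \<omega>))"
    using ident assms unfolding ident_distr_seq_def by blast
  then show ?thesis unfolding Er_def by (rule arg_cong)
qed

text \<open>The inner expectation in the independence identity: earlier coordinates are frozen at
  \<open>x\<close>, and \<open>X n\<close> is integrated out.\<close>

definition cond :: "nat \<Rightarrow> ((nat \<Rightarrow> real) \<Rightarrow> real) \<Rightarrow> (nat \<Rightarrow> real) \<Rightarrow> real" where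
  "cond n \<phi> x = Er (\<lambda>\<omega>. \<phi> (x(n := X n \<omega>)))"

lemma C_bLip_section:
  assumes "\<phi> \<in> C_bLip (Suc n)"
  shows "(\<lambda>y. \<phi> (x(n := y 0))) \<in> C_bLip 1"
  using assms
proof (rule C_bLipE)
  fix K L assume *: "\<And>x. \<bar>\<phi> x\<bar> \<le> K"
    "\<And>x y. \<bar>\<phi> x - \<phi> y\<bar> \<le> L * L2_set (\<lambda>i. x i - y i) {..<Suc n}"
  have "\<bar>\<phi> (x(n := a)) - \<phi> (x(n := b))\<bar> \<le> L * \<bar>a - b\<bar>" for a b
    using *(2)[of "x(n := a)" "x(n := b)"] unfolding L2_set_fun_upd_last by (simp add: L2_set_def)
  then show ?thesis by (intro C_bLip_coord[of "\<lambda>a. \<phi> (x(n := a))" K L] *(1)) auto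
qed

lemma bdd_section:
  assumes "\<phi> \<in> C_bLip (Suc n)"
  shows "(\<lambda>\<omega>. \<phi> (x(n := X k \<omega>))) \<in> H_bdd M H"
  using bdd_X1[OF C_bLip_section[OF assms], of x k] by simp

text \<open>The Lipschitz estimate \<open>\<phi> (x, a) \<le> D + \<phi> (y, a)\<close> is uniform
  in the last coordinate \<open>a\<close>, and adding a constant commutes with \<open>Er\<close>, so
  the Lipschitz constant is inherited.\<close>

lemma cond_C_bLip:
  assumes \<phi>: "\<phi> \<in> C_bLip (Suc n)"
  shows "cond n \<phi> \<in> C_bLip n"
proof -
  obtain K L where "L \<ge> 0" and K: "\<And>x. \<bar>\<phi> x\<bar> \<le> K"
    and L: "\<And>x y. \<bar>\<phi> x - \<phi> y\<bar> \<le> L * L2_set (\<lambda>i. x i - y i) {..<Suc n}"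
    using \<phi> by (elim C_bLipE) blast
  have le: "cond n \<phi> x - cond n \<phi> y \<le> L * L2_set (\<lambda>i. x i - y i) {..<n}" (is "_ \<le> ?D") for x y
  proof -
    have *: "\<phi> (x(n := a)) \<le> ?D + 1 * \<phi> (y(n := a))" for a
      using L[of "x(n := a)" "y(n := a)"] unfolding L2_set_fun_upd_last by simp
    have "cond n \<phi> x \<le> Er (\<lambda>\<omega>. ?D + 1 * \<phi> (y(n := X n \<omega>)))"
      unfolding cond_def
      by (intro Er_mono bdd_add bdd_const bdd_scale bdd_section[OF \<phi>] *)
    also have "\<dots> = ?D + 1 * cond n \<phi> y"
      unfolding cond_def by (intro Er_affine bdd_section[OF \<phi>]) simp
    finally show ?thesis by simp
  qed
  show ?thesis
  proof (rule C_bLipI)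
    fix x y
    have "L2_set (\<lambda>i. y i - x i) {..<n} = L2_set (\<lambda>i. x i - y i) {..<n}"
      unfolding L2_set_def by (simp add: power2_commute)
    then show "\<bar>cond n \<phi> x - cond n \<phi> y\<bar> \<le> L * L2_set (\<lambda>i. x i - y i) {..<n}"
      using le[of x y] le[of y x] by simp
    have "- K \<le> \<phi> z" "\<phi> z \<le> K" for z using K[of z] by (auto simp: abs_le_iff)
    then have "Er (\<lambda>_. - K) \<le> cond n \<phi> x" "cond n \<phi> x \<le> Er (\<lambda>_. K)"
      unfolding cond_def by (intro Er_mono bdd_const bdd_section[OF \<phi>]; simp)+
    then show "\<bar>cond n \<phi> x\<bar> \<le> K" by (simp add: Er_const abs_le_iff)
  qed
qed

text \<open>For bounded Lipschitz \<open>\<phi>\<close> all side conditions of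
  \<open>indep_to\<close> hold: the inner expectations are again bounded Lipschitz functions, so
  composed with \<open>X\<close> they lie in \<open>H\<close> and have finite expectation.\<close>

lemma Er_cond:
  assumes "n \<ge> 1" and \<phi>: "\<phi> \<in> C_bLip (Suc n)"
  shows "Er (\<lambda>\<omega>. \<phi> (\<lambda>i. X i \<omega>)) = Er (\<lambda>\<omega>. cond n \<phi> (\<lambda>i. X i \<omega>))"
proof -
  \<comment> \<open>The two ways of appending \<open>y\<close> differ only beyond coordinate
    \<open>n\<close>, which \<psi> does not see.\<close>
  have join: "\<psi> (vec_join n x (\<lambda>i. y)) = \<psi> (x(n := y))" if "\<psi> \<in> C_bLip (Suc n)" for \<psi> x y
    by (rule C_bLip_cong[OF that]) (auto simp: vec_join_def)
  have upd: "(\<lambda>i. X i \<omega>)(n := X n \<omega>) = (\<lambda>i. X i \<omega>)" for \<omega>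
    by auto
  have abs: "(\<lambda>x. \<bar>\<phi> x\<bar>) \<in> C_bLip (Suc n)" by (rule C_bLip_abs[OF \<phi>])
  have E_cond: "E (\<lambda>\<omega>. \<psi> (x(n := X n \<omega>))) = ereal (cond n \<psi> x)" if "\<psi> \<in> C_bLip (Suc n)" for \<psi> x
    unfolding cond_def by (rule E_eq_Er[OF bdd_section[OF that]])
  note bdd = bdd_X[OF cond_C_bLip[OF abs]] bdd_X[OF cond_C_bLip[OF \<phi>]]
  have fin: "E (\<lambda>\<omega>. \<bar>cond n (\<lambda>x. \<bar>\<phi> x\<bar>) (\<lambda>i. X i \<omega>)\<bar>) < \<infinity>"
    by (subst E_eq_Er[OF bdd_X[OF C_bLip_abs[OF cond_C_bLip[OF abs]]]]) simp
  have "indep_to H E 1 (\<lambda>_. X n) n X" using indep \<open>n \<ge> 1\<close> unfolding indep_seq_def by blast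
  from this[unfolded indep_to_def, rule_format, of \<phi>]
  have "E (\<lambda>\<omega>. \<phi> (\<lambda>i. X i \<omega>)) = E (\<lambda>\<omega>. cond n \<phi> (\<lambda>i. X i \<omega>))"
    using C_bLip_imp_C_lLip[OF \<phi>] bdd_H[OF bdd(1)] bdd_H[OF bdd(2)] fin
    by (simp add: join[OF \<phi>] join[OF abs] upd E_cond[OF \<phi>] E_cond[OF abs] Let_def)
  then show ?thesis unfolding Er_def by simp
qed

text \<open>Induction on the number of variables: the last one is integrated out by
  \<open>cond\<close>, which commutes with negation by the one-variable hypothesis and identical
  distribution.\<close>

lemma mean_certain_C_bLip:
  assumes certain: "\<And>\<psi>. \<psi> \<in> C_bLip 1 \<Longrightarrow>
      Er (\<lambda>\<omega>. - \<psi> (\<lambda>_. X 0 \<omega>)) = - Er (\<lambda>\<omega>. \<psi> (\<lambda>_. X 0 \<omega>))"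
    and "\<phi> \<in> C_bLip (Suc n)"
  shows "Er (\<lambda>\<omega>. - \<phi> (\<lambda>i. X i \<omega>)) = - Er (\<lambda>\<omega>. \<phi> (\<lambda>i. X i \<omega>))"
  using assms(2)
proof (induction n arbitrary: \<phi>)
  case 0
  have "\<phi> (\<lambda>i. X i \<omega>) = \<phi> (\<lambda>_. X 0 \<omega>)" for \<omega>
    by (rule C_bLip_cong[OF 0]) simp
  then show ?case using certain[of \<phi>] 0 by simp
next
  case (Suc n)
  have "cond (Suc n) (\<lambda>x. - \<phi> x) x = - cond (Suc n) \<phi> x" for x
  proof -
    let ?\<psi> = "\<lambda>y. \<phi> (x(Suc n := y 0))"
    have \<psi>: "?\<psi> \<in> C_bLip 1" by (rule C_bLip_section[OF Suc.prems])
    show ?thesis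
      unfolding cond_def
      using certain[OF \<psi>] Er_X1[OF \<psi>, of "Suc n"] Er_X1[OF C_bLip_uminus[OF \<psi>], of "Suc n"] by simp
  qed
  then show ?case
    using Er_cond[OF _ Suc.prems] Er_cond[OF _ C_bLip_uminus[OF Suc.prems]]
      Suc.IH[OF cond_C_bLip[OF Suc.prems]] by simp
qed

text \<open>Two truncations. Clamping \<open>Y\<close> at \<open>c\<close> costs the positive part
  of \<open>\<bar>Y\<bar> - c\<close>, small by the definition of \<open>H_tilde\<close>. Clamping
  the arguments at \<open>d\<close> then costs at most \<open>2 * c\<close>, and only where some
  \<open>\<bar>X i\<bar>\<close> exceeds \<open>d\<close>; continuity along decreasing sequences
  makes this small.\<close>

lemma mean_certain_H_tilde:
  assumes certain: "\<And>\<psi>. \<psi> \<in> C_bLip 1 \<Longrightarrow>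
      Er (\<lambda>\<omega>. - \<psi> (\<lambda>_. X 0 \<omega>)) = - Er (\<lambda>\<omega>. \<psi> (\<lambda>_. X 0 \<omega>))"
    and Y: "Y \<in> H_tilde E X"
  shows "mean_certain Y"
proof -
  obtain n \<phi> where n: "n \<ge> 1" and \<phi>: "\<phi> \<in> C_lLip n" and Y_def: "Y = (\<lambda>\<omega>. \<phi> (\<lambda>i. X i \<omega>))"
    and ui: "((\<lambda>c::real. E (\<lambda>\<omega>. max (\<bar>Y \<omega>\<bar> - c) 0)) \<longlongrightarrow> 0) at_top"
    using Y unfolding H_tilde_def by auto
  have YH: "Y \<in> H" unfolding Y_def by (rule compose[OF n \<phi> X_H])
  have bounded_case: "mean_certain (\<lambda>\<omega>. clamp1 c (Y \<omega>))" if c: "c \<ge> 0" for c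
  proof (rule mean_certain_approx)
    show ZH: "(\<lambda>\<omega>. clamp1 c (Y \<omega>)) \<in> H" by (intro H_max H_min YH)
    fix \<epsilon> :: real assume "\<epsilon> > 0"
    \<comment> \<open>A Lipschitz majorant of the indicator of \<open>\<bar>a\<bar> \<ge> R\<close>:
      it vanishes for \<open>\<bar>a\<bar> \<le> R - 1\<close> and is 1 from \<open>R\<close>
      on.\<close>
    define t :: "real \<Rightarrow> real \<Rightarrow> real" where "t R a = max 0 (min 1 (\<bar>a\<bar> - R + 1))" for R a
    have clamp_Lipschitz: "\<bar>max 0 (min 1 p) - max 0 (min 1 q)\<bar> \<le> \<bar>p - q\<bar>" for p q :: real
      by auto
    have t_Lipschitz: "\<bar>t R a - t R b\<bar> \<le> 1 * \<bar>a - b\<bar>" for R a b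
    proof -
      have "\<bar>t R a - t R b\<bar> \<le> \<bar>(\<bar>a\<bar> - R + 1) - (\<bar>b\<bar> - R + 1)\<bar>"
        unfolding t_def by (rule clamp_Lipschitz)
      also have "\<dots> \<le> 1 * \<bar>a - b\<bar>" using abs_triangle_ineq3[of a b] by simp
      finally show ?thesis .
    qed
    have t: "(\<lambda>x. \<Sum>i<n. t R (x i)) \<in> C_bLip n" for R
      by (intro C_bLip_sum C_bLip_coord[of "t R" 1 1] t_Lipschitz) (auto simp: t_def)
    define \<tau> where "\<tau> d \<omega> = (\<Sum>i<n. t (real d) (X i \<omega>))" for d \<omega>
    have \<tau>: "\<tau> d \<in> H_bdd M H" for d
      using bdd_X[OF t, of "real d"] unfolding \<tau>_def[abs_def] .
    \<comment> \<open>Two values clamped at \<open>c\<close> differ by at most \<open>2 * c\<close>;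
      the extra 1 keeps the denominator positive for \<open>c = 0\<close>.\<close>
    have "\<exists>d. Er (\<tau> d) \<le> \<epsilon> / (2 * c + 1)"
    proof (rule Er_decreasing_to_0[OF \<tau>])
      show "\<tau> e \<omega> \<le> \<tau> d \<omega>" if "d \<le> e" for d e \<omega>
        unfolding \<tau>_def t_def using that by (intro sum_mono) auto
      show "0 \<le> \<tau> d \<omega>" for d \<omega>
        unfolding \<tau>_def t_def by (intro sum_nonneg) auto
      have "(\<lambda>d. t (real d) a) \<longlonglongrightarrow> 0" for a
      proof (rule tendsto_eventually)
        obtain N :: nat where N: "\<bar>a\<bar> + 1 \<le> real N" using real_arch_simple by blast
        show "\<forall>\<^sub>F d in sequentially. t (real d) a = 0"
          using eventually_ge_at_top[of N] by eventually_elim (use N in \<open>auto simp: t_def\<close>)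
      qed
      then show "(\<lambda>d. \<tau> d \<omega>) \<longlonglongrightarrow> 0" for \<omega>
        unfolding \<tau>_def by (intro tendsto_null_sum)
      show "0 < \<epsilon> / (2 * c + 1)" using \<open>\<epsilon> > 0\<close> c by simp
    qed
    then obtain d where d: "Er (\<tau> d) \<le> \<epsilon> / (2 * c + 1)" by blast
    define \<theta> where "\<theta> = (\<lambda>x. clamp1 c (\<phi> (\<lambda>i. clamp1 (real d) (x i))))"
    let ?Z = "\<lambda>\<omega>. \<theta> (\<lambda>i. X i \<omega>)"
    have \<theta>: "\<theta> \<in> C_bLip n" unfolding \<theta>_def by (rule C_lLip_clamp[OF \<phi> c]) simp
    have "Suc (n - 1) = n" using n by simp
    with \<theta> have \<theta>': "\<theta> \<in> C_bLip (Suc (n - 1))" by (simp only:)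
    have "mean_certain ?Z"
      unfolding mean_certain_bdd[OF bdd_X[OF \<theta>]] by (rule mean_certain_C_bLip[OF certain \<theta>'])
    moreover have "E (\<lambda>\<omega>. \<bar>clamp1 c (Y \<omega>) - ?Z \<omega>\<bar>) \<le> ereal \<epsilon>"
    proof -
      have le: "\<bar>clamp1 c (Y \<omega>) - ?Z \<omega>\<bar> \<le> (2 * c + 1) * \<tau> d \<omega>" for \<omega>
      proof (cases "\<forall>i<n. \<bar>X i \<omega>\<bar> \<le> real d")
        case True
        have "\<phi> (\<lambda>i. X i \<omega>) = \<phi> (\<lambda>i. clamp1 (real d) (X i \<omega>))"
          by (rule C_lLip_cong[OF \<phi>]) (use True in \<open>auto simp: abs_le_iff\<close>)
        then have "\<bar>clamp1 c (Y \<omega>) - ?Z \<omega>\<bar> = 0" unfolding Y_def \<theta>_def by (simp only: diff_self abs_zero)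
        also have "0 \<le> (2 * c + 1) * \<tau> d \<omega>"
          unfolding \<tau>_def t_def using c by (intro mult_nonneg_nonneg sum_nonneg) auto
        finally show ?thesis .
      next
        case False
        then obtain i where i: "i < n" "\<bar>X i \<omega>\<bar> > real d" by auto
        have "1 = t (real d) (X i \<omega>)" using i(2) by (simp add: t_def)
        also have "\<dots> \<le> \<tau> d \<omega>"
          unfolding \<tau>_def using i(1) by (intro member_le_sum) (auto simp: t_def)
        finally have \<tau>1: "1 \<le> \<tau> d \<omega>" .
        have "\<bar>clamp1 c a\<bar> \<le> c" for a using c by auto
        then have "\<bar>clamp1 c (Y \<omega>) - ?Z \<omega>\<bar> \<le> c + c"
          unfolding \<theta>_def by (intro order_trans[OF abs_triangle_ineq4] add_mono)
        also have "\<dots> \<le> (2 * c + 1) * 1" by simp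
        also have "\<dots> \<le> (2 * c + 1) * \<tau> d \<omega>"
          using c \<tau>1 by (intro mult_left_mono) auto
        finally show ?thesis .
      qed
      have "E (\<lambda>\<omega>. \<bar>clamp1 c (Y \<omega>) - ?Z \<omega>\<bar>) \<le> E (\<lambda>\<omega>. (2 * c + 1) * \<tau> d \<omega>)"
        by (intro E_mono H_abs H_diff ZH bdd_H[OF bdd_X[OF \<theta>]] scale bdd_H[OF \<tau>] le)
      also have "\<dots> = ereal ((2 * c + 1) * Er (\<tau> d))"
        using c by (simp add: E_eq_Er bdd_scale \<tau> Er_scale)
      also have "(2 * c + 1) * Er (\<tau> d) \<le> \<epsilon>"
        using d c by (simp add: field_simps)
      finally show ?thesis by simp
    qed
    ultimately show "\<exists>Z. mean_certain Z \<and> E (\<lambda>\<omega>. \<bar>clamp1 c (Y \<omega>) - Z \<omega>\<bar>) \<le> ereal \<epsilon>"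
      by (intro exI[of _ ?Z] conjI)
  qed
  show ?thesis
  proof (rule mean_certain_approx[OF YH])
    fix \<epsilon> :: real assume "\<epsilon> > 0"
    then have "\<forall>\<^sub>F c in at_top. E (\<lambda>\<omega>. max (\<bar>Y \<omega>\<bar> - c) 0) < ereal \<epsilon>"
      using order_tendstoD(2)[OF ui] by simp
    then have "\<forall>\<^sub>F c in at_top. E (\<lambda>\<omega>. max (\<bar>Y \<omega>\<bar> - c) 0) < ereal \<epsilon> \<and> c \<ge> 0"
      using eventually_ge_at_top by (rule eventually_conj)
    then obtain c where c: "E (\<lambda>\<omega>. max (\<bar>Y \<omega>\<bar> - c) 0) < ereal \<epsilon>" "c \<ge> 0"
      using eventually_happens'[OF trivial_limit_at_top_linorder] by blast
    have "\<bar>Y \<omega> - clamp1 c (Y \<omega>)\<bar> = max (\<bar>Y \<omega>\<bar> - c) 0" for \<omega>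
      using c(2) by (auto simp: max_def min_def)
    then have "E (\<lambda>\<omega>. \<bar>Y \<omega> - clamp1 c (Y \<omega>)\<bar>) \<le> ereal \<epsilon>"
      using less_imp_le[OF c(1)] by (simp only:)
    then show "\<exists>Z. mean_certain Z \<and> E (\<lambda>\<omega>. \<bar>Y \<omega> - Z \<omega>\<bar>) \<le> ereal \<epsilon>"
      using bounded_case[OF c(2)] by (intro exI[of _ "\<lambda>\<omega>. clamp1 c (Y \<omega>)"] conjI)
  qed
qed

end

section \<open>Disjoint events of full capacity\<close>

context iid_CC_space
begin

text \<open>With the first \<open>n\<close> coordinates frozen, \<open>f\<close> and
  \<open>g\<close> are constants and \<open>g \<ge> 0\<close>, so the inner expectation is
  \<open>- f + g * Er (- w)\<close>, which is at least \<open>- f - g * q\<close>. Here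
  \<open>q\<close> bounds the lower expectation of \<open>w\<close>.\<close>

lemma Er_one_step:
  assumes n: "n \<ge> 1" and f: "f \<in> C_bLip n" and g: "g \<in> C_bLip n" and g0: "\<And>x. 0 \<le> g x"
    and w: "w \<in> C_bLip 1" and q: "- q \<le> Er (\<lambda>\<omega>. - w (\<lambda>_. X n \<omega>))"
  shows "Er (\<lambda>\<omega>. - (f (\<lambda>i. X i \<omega>) + g (\<lambda>i. X i \<omega>) * q))
      \<le> Er (\<lambda>\<omega>. - (f (\<lambda>i. X i \<omega>) + g (\<lambda>i. X i \<omega>) * w (\<lambda>_. X n \<omega>)))"
proof -
  let ?\<phi> = "\<lambda>x. - (f x + g x * w (\<lambda>_. x n))"
  have \<phi>: "?\<phi> \<in> C_bLip (Suc n)"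
    using C_bLip_mono[OF _ f, of "Suc n"] C_bLip_mono[OF _ g, of "Suc n"]
    by (intro C_bLip_uminus C_bLip_add C_bLip_mult C_bLip_at[OF w]) auto
  have fq: "(\<lambda>x. - (f x + g x * q)) \<in> C_bLip n"
    by (intro C_bLip_uminus C_bLip_add C_bLip_mult C_bLip_const f g)
  have "- (f x + g x * q) \<le> cond n ?\<phi> x" for x
  proof -
    have upd: "f (x(n := a)) = f x" "g (x(n := a)) = g x" for a
      by (rule C_bLip_cong[OF f], simp) (rule C_bLip_cong[OF g], simp)
    have "cond n ?\<phi> x = Er (\<lambda>\<omega>. - f x + g x * - w (\<lambda>_. X n \<omega>))"
      unfolding cond_def by (simp add: upd)
    also have "\<dots> = - f x + g x * Er (\<lambda>\<omega>. - w (\<lambda>_. X n \<omega>))"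
      by (rule Er_affine[OF bdd_uminus[OF bdd_X1[OF w]] g0])
    finally show ?thesis using mult_left_mono[OF q g0[of x]] by simp
  qed
  then have "Er (\<lambda>\<omega>. - (f (\<lambda>i. X i \<omega>) + g (\<lambda>i. X i \<omega>) * q)) \<le> Er (\<lambda>\<omega>. cond n ?\<phi> (\<lambda>i. X i \<omega>))"
    by (intro Er_mono bdd_X[OF fq] bdd_X[OF cond_C_bLip[OF \<phi>]])
  also have "\<dots> = Er (\<lambda>\<omega>. ?\<phi> (\<lambda>i. X i \<omega>))"
    by (rule Er_cond[OF n \<phi>, symmetric])
  finally show ?thesis .
qed

text \<open>
  The index sets \<open>{prod_encode (j, i) | i < j}\<close> are disjoint. In \<open>partial_block z q n j\<close> the factors that
  depend on \<open>X\<^sub>n, X\<^sub>n\<^sub>+\<^sub>1, \<dots>\<close> are replaced by a bound \<open>q\<close> for their lower expectation, so that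
  sums of partial blocks decrease in lower expectation as \<open>n\<close> grows.
\<close>

definition block :: "(nat \<Rightarrow> (nat \<Rightarrow> real) \<Rightarrow> real) \<Rightarrow> nat \<Rightarrow> (nat \<Rightarrow> real) \<Rightarrow> real" where
  "block z j x = (\<Prod>i<j. z j (\<lambda>_. x (prod_encode (j, i))))"

definition partial_block ::
    "(nat \<Rightarrow> (nat \<Rightarrow> real) \<Rightarrow> real) \<Rightarrow> real \<Rightarrow> nat \<Rightarrow> nat \<Rightarrow> (nat \<Rightarrow> real) \<Rightarrow> real" where
  "partial_block z q n j x =
     (\<Prod>i<j. if prod_encode (j, i) < n then z j (\<lambda>_. x (prod_encode (j, i))) else q)"

lemma partial_block_C_bLip:
  assumes "\<And>j. z j \<in> C_bLip 1"
  shows "partial_block z q n j \<in> C_bLip n"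
proof -
  have "(\<lambda>x. if prod_encode (j, i) < n then z j (\<lambda>_. x (prod_encode (j, i))) else q) \<in> C_bLip n" for i
    using C_bLip_at[OF assms] C_bLip_const by (cases "prod_encode (j, i) < n") auto
  then show ?thesis
    unfolding partial_block_def[abs_def] by (rule C_bLip_prod)
qed

text \<open>Passing from \<open>n\<close> to \<open>Suc n\<close> reveals only \<open>X n\<close>.
  If \<open>n\<close> encodes \<open>(j0, i0)\<close>, at most factor \<open>i0\<close> of block
  \<open>j0\<close> changes, from \<open>q\<close> to its true value; everything else depends on the
  first \<open>n\<close> coordinates, so the one-step estimate applies.\<close>

lemma partial_block_step:
  assumes z: "\<And>j. z j \<in> C_bLip 1" "\<And>j x. 0 \<le> z j x"
    and q: "0 \<le> q" "\<And>j k. - q \<le> Er (\<lambda>\<omega>. - z j (\<lambda>_. X k \<omega>))"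
    and n: "n \<ge> 1" and "finite B"
  shows "Er (\<lambda>\<omega>. - (\<Sum>j\<in>B. partial_block z q n j (\<lambda>i. X i \<omega>)))
      \<le> Er (\<lambda>\<omega>. - (\<Sum>j\<in>B. partial_block z q (Suc n) j (\<lambda>i. X i \<omega>)))"
proof -
  obtain j0 i0 where n_def: "n = prod_encode (j0, i0)"
    by (metis prod.exhaust prod_decode_inverse)
  let ?F = "\<lambda>n j i x. if prod_encode (j, i) < n then z j (\<lambda>_. x (prod_encode (j, i))) else q"
  have same: "?F (Suc n) j i x = ?F n j i x" if "(j, i) \<noteq> (j0, i0)" for j i x
    using that prod_encode_eq[of "(j, i)" "(j0, i0)"] unfolding n_def by (auto simp: less_Suc_eq)
  have same_block: "partial_block z q (Suc n) j x = partial_block z q n j x"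
    if "j \<noteq> j0 \<or> j \<le> i0" for j x
    unfolding partial_block_def by (rule prod.cong[OF refl], rule same) (use that in auto)
  show ?thesis
  proof (cases "j0 \<in> B \<and> i0 < j0")
    case False
    then have "partial_block z q (Suc n) j x = partial_block z q n j x" if "j \<in> B" for j x
      using that by (intro same_block) (auto simp: not_less)
    then show ?thesis by (simp cong: sum.cong)
  next
    case True
    let ?f = "\<lambda>x. \<Sum>j\<in>B - {j0}. partial_block z q n j x"
    let ?g = "\<lambda>x. \<Prod>i\<in>{..<j0} - {i0}. ?F n j0 i x"
    have split: "(\<Sum>j\<in>B. h j) = (\<Sum>j\<in>B - {j0}. h j) + h j0" for h :: "nat \<Rightarrow> real"
      using sum.remove[OF \<open>finite B\<close>, of j0 h] True by simp
    have psplit: "(\<Prod>i<j0. h i) = (\<Prod>i\<in>{..<j0} - {i0}. h i) * h i0" for h :: "nat \<Rightarrow> real"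
      using prod.remove[of "{..<j0}" i0 h] True by (simp add: mult.commute)
    have now: "partial_block z q n j0 x = ?g x * q" for x
      unfolding partial_block_def psplit by (simp add: n_def)
    have "partial_block z q (Suc n) j0 x = ?g x * z j0 (\<lambda>_. x n)" for x
    proof -
      have "(\<Prod>i\<in>{..<j0} - {i0}. ?F (Suc n) j0 i x) = ?g x"
        by (intro prod.cong refl same) auto
      then show ?thesis unfolding partial_block_def psplit by (simp add: n_def)
    qed
    then have after: "(\<Sum>j\<in>B. partial_block z q (Suc n) j x) = ?f x + ?g x * z j0 (\<lambda>_. x n)" for x
      unfolding split by (simp add: same_block)
    have before: "(\<Sum>j\<in>B. partial_block z q n j x) = ?f x + ?g x * q" for x
      unfolding split now ..
    have f: "?f \<in> C_bLip n"
      by (intro C_bLip_sum partial_block_C_bLip z)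
    have g: "?g \<in> C_bLip n"
    proof (rule C_bLip_prod)
      show "?F n j0 i \<in> C_bLip n" for i
        using C_bLip_at[OF z(1)] C_bLip_const by (cases "prod_encode (j0, i) < n") auto
    qed
    have g0: "0 \<le> ?g x" for x using z(2) q(1) by (intro prod_nonneg) auto
    show ?thesis
      unfolding before after by (rule Er_one_step[OF n f g g0 z(1) q(2)])
  qed
qed

text \<open>Starting from blocks with all factors equal to \<open>q\<close>, the variables are
  revealed one at a time until the finitely many indices in use are exhausted; the lower expectation
  of the sum never rises.\<close>

lemma sum_blocks:
  assumes z: "\<And>j. z j \<in> C_bLip 1" "\<And>j x. 0 \<le> z j x"
    and q: "0 \<le> q" "\<And>j k. - q \<le> Er (\<lambda>\<omega>. - z j (\<lambda>_. X k \<omega>))"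
    and "finite B" "0 \<notin> B"
  shows "(\<lambda>\<omega>. \<Sum>j\<in>B. block z j (\<lambda>i. X i \<omega>)) \<in> H_bdd M H"
    and "- (\<Sum>j\<in>B. q ^ j) \<le> Er (\<lambda>\<omega>. - (\<Sum>j\<in>B. block z j (\<lambda>i. X i \<omega>)))"
proof -
  let ?\<Phi> = "\<lambda>n \<omega>. \<Sum>j\<in>B. partial_block z q n j (\<lambda>i. X i \<omega>)"
  have "finite (prod_encode ` (SIGMA j:B. {..<j}))" using \<open>finite B\<close> by simp
  then obtain N where "\<forall>k \<in> prod_encode ` (SIGMA j:B. {..<j}). k < N"
    unfolding finite_nat_set_iff_bounded by blast
  then have "block z j x = partial_block z q N j x" if "j \<in> B" for j x
    unfolding block_def partial_block_def using that by (intro prod.cong refl) auto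
  then have N: "(\<lambda>\<omega>. \<Sum>j\<in>B. block z j (\<lambda>i. X i \<omega>)) = ?\<Phi> N"
    by (intro ext sum.cong) auto
  show "(\<lambda>\<omega>. \<Sum>j\<in>B. block z j (\<lambda>i. X i \<omega>)) \<in> H_bdd M H"
    unfolding N by (intro bdd_X[where n=N] C_bLip_sum partial_block_C_bLip z)
  \<comment> \<open>Index 0 encodes \<open>(0, 0)\<close> and belongs to no block in
    \<open>B\<close>. Hence no factor is revealed for \<open>n \<le> 1\<close>, and the induction
    can begin at 1, as independence starts at index 1.\<close>
  have "prod_encode (j, i) \<noteq> 0" if "j \<in> B" for j i
    using that \<open>0 \<notin> B\<close> prod_encode_eq[of "(j, i)" "(0, 0)"] by (auto simp: prod_encode_def)
  then have "\<not> prod_encode (j, i) < n" if "n \<le> 1" "j \<in> B" for n j i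
    using that by (metis less_one order_less_le_trans)
  then have "partial_block z q n j x = q ^ j" if "n \<le> 1" "j \<in> B" for n j x
    unfolding partial_block_def using that by simp
  then have start: "?\<Phi> n = (\<lambda>_. \<Sum>j\<in>B. q ^ j)" if "n \<le> 1" for n
    using that by (intro ext sum.cong) auto
  have "- (\<Sum>j\<in>B. q ^ j) \<le> Er (\<lambda>\<omega>. - ?\<Phi> n \<omega>)" for n
  proof (induction n)
    case 0
    then show ?case using Er_const[of "- (\<Sum>j\<in>B. q ^ j)"] by (simp add: fun_cong[OF start])
  next
    case (Suc n)
    show ?case
    proof (cases "n \<ge> 1")
      case True
      then show ?thesis
        using Suc.IH partial_block_step[OF z q True \<open>finite B\<close>] by (rule_tac order_trans)
    next
      case False
      then show ?thesis
        using Er_const[of "- (\<Sum>j\<in>B. q ^ j)"] by (simp add: fun_cong[OF start])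
    qed
  qed
  from this[of N] show "- (\<Sum>j\<in>B. q ^ j) \<le> Er (\<lambda>\<omega>. - (\<Sum>j\<in>B. block z j (\<lambda>i. X i \<omega>)))"
    using N by (simp add: fun_eq_iff)
qed

section \<open>Measurability and capacity of the event that blocks are eventually below 1\<close>

lemma block_measurable:
  assumes "\<And>j. z j \<in> C_bLip 1"
  shows "(\<lambda>\<omega>. block z j (\<lambda>i. X i \<omega>)) \<in> borel_measurable (sigma_gen M (range X))"
proof -
  have "(\<lambda>\<omega>. z j (\<lambda>_. X k \<omega>)) \<in> borel_measurable (sigma_gen M (range X))" for k
  proof -
    obtain L where "L \<ge> 0" and L: "\<And>a b. \<bar>z j (\<lambda>_. a) - z j (\<lambda>_. b)\<bar> \<le> L * \<bar>a - b\<bar>"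
      using assms[of j] by (elim C_bLip_1E) blast
    then have "L-lipschitz_on UNIV (\<lambda>a. z j (\<lambda>_. a))"
      by (intro lipschitz_onI) (auto simp: dist_real_def)
    then have "continuous_on UNIV (\<lambda>a. z j (\<lambda>_. a))"
      by (rule lipschitz_on_continuous_on)
    from borel_measurable_continuous_onI[OF this] show ?thesis
      by (rule measurable_compose[OF measurable_sigma_gen[OF rangeI]])
  qed
  then show ?thesis unfolding block_def by (intro borel_measurable_prod)
qed

definition eventually_small :: "(nat \<Rightarrow> (nat \<Rightarrow> real) \<Rightarrow> real) \<Rightarrow> 'a set" where
  "eventually_small z = {\<omega> \<in> space M. \<exists>J. \<forall>j\<ge>J. block z j (\<lambda>i. X i \<omega>) < 1}"

lemma eventually_small_sets:
  assumes "\<And>j. z j \<in> C_bLip 1"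
  shows "eventually_small z \<in> sets (sigma_gen M (range X))"
proof -
  let ?N = "sigma_gen M (range X)"
  let ?S = "\<lambda>j. {\<omega> \<in> space ?N. block z j (\<lambda>i. X i \<omega>) < 1}"
  have S: "?S j \<in> sets ?N" for j
    using block_measurable[of z j, OF assms] by (rule borel_measurable_less) simp
  have "eventually_small z = (\<Union>J. \<Inter>j\<in>{J..}. ?S j)"
    unfolding eventually_small_def by auto
  also have "\<dots> \<in> sets ?N"
    using S by (intro sets.countable_UN sets.countable_INT image_subsetI) auto
  finally show ?thesis .
qed

text \<open>For blocks from \<open>J\<close> on, the lower expectation of the sums is at most a
  geometric tail. Compactness gives one \<open>P\<close> with small integrals of all capped sums, so
  by a Markov estimate the probability that some such block reaches 1 is small. Then
  \<open>J\<close> tends to infinity.\<close>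

lemma eventually_small_V_fam:
  assumes z: "\<And>j. z j \<in> C_bLip 1" "\<And>j x. 0 \<le> z j x"
    and q: "0 < q" "q < 1" "\<And>j k. - q \<le> Er (\<lambda>\<omega>. - z j (\<lambda>_. X k \<omega>))"
  shows "1 \<le> V_fam \<P> (eventually_small z)"
proof -
  define \<delta> where "\<delta> J = q ^ J / (1 - q)" for J :: nat
  have sub: "sets (sigma_gen M (range X)) \<subseteq> sets (sigma_gen M H)"
    by (rule sigma_gen_mono) (use X_H in auto)
  have block0: "0 \<le> block z j x" for j x
    unfolding block_def using z(2) by (intro prod_nonneg) auto
  have lower: "ereal (1 - 2 * \<delta> J) \<le> V_fam \<P> (eventually_small z)" if "J \<ge> 1" for J
  proof -
    define S where "S d \<omega> = (\<Sum>j\<in>{J..<J + d}. block z j (\<lambda>i. X i \<omega>))" for d \<omega>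
    have S0: "0 \<le> S d \<omega>" for d \<omega>
      unfolding S_def using block0 by (intro sum_nonneg)
    have S_mono: "S d \<omega> \<le> S e \<omega>" if "d \<le> e" for d e \<omega>
      unfolding S_def using block0 that by (intro sum_mono2) auto
    have \<delta>: "0 < \<delta> J" unfolding \<delta>_def using q by simp
    have S_bdd: "S d \<in> H_bdd M H" for d
      using sum_blocks(1)[OF z less_imp_le[OF q(1)] q(3), of "{J..<J + d}"] \<open>J \<ge> 1\<close>
      unfolding S_def[abs_def] by simp
    have min_bdd: "(\<lambda>\<omega>. min 1 (S d \<omega>)) \<in> H_bdd M H" for d
      using S0 by (intro bddI[of _ 1] H_min bdd_H[OF S_bdd]) auto
    \<comment> \<open>The tail bound is doubled to obtain the strict inequality that
      \<open>CC_decreasing\<close> asks for.\<close>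
    have "- (2 * \<delta> J) < Er (\<lambda>\<omega>. - min 1 (S d \<omega>))" for d
    proof -
      have "(\<Sum>j\<in>{J..<J + d}. q ^ j) = q ^ J * (\<Sum>j<d. q ^ j)"
        by (induction d) (auto simp: power_add algebra_simps)
      also have "\<dots> = q ^ J * ((1 - q ^ d) / (1 - q))"
        using q by (simp add: sum_gp_strict)
      also have "\<dots> \<le> q ^ J * (1 / (1 - q))"
        using q by (intro mult_left_mono divide_right_mono) auto
      finally have "(\<Sum>j\<in>{J..<J + d}. q ^ j) \<le> \<delta> J" unfolding \<delta>_def by simp
      moreover have "- (\<Sum>j\<in>{J..<J + d}. q ^ j) \<le> Er (\<lambda>\<omega>. - S d \<omega>)"
        using sum_blocks(2)[OF z less_imp_le[OF q(1)] q(3), of "{J..<J + d}"] \<open>J \<ge> 1\<close>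
        unfolding S_def by simp
      moreover have "Er (\<lambda>\<omega>. - S d \<omega>) \<le> Er (\<lambda>\<omega>. - min 1 (S d \<omega>))"
        by (intro Er_mono bdd_uminus S_bdd min_bdd) simp
      ultimately show ?thesis using \<delta> by linarith
    qed
    moreover have "- min 1 (S e \<omega>) \<le> - min 1 (S d \<omega>)" if "d \<le> e" for d e \<omega>
      using min.mono[OF order_refl S_mono[OF that]] by simp
    ultimately obtain P where P: "P \<in> \<P>" "\<And>d. - (2 * \<delta> J) \<le> (\<integral>\<omega>. - min 1 (S d \<omega>) \<partial>P)"
      using CC_decreasing[of "\<lambda>d \<omega>. - min 1 (S d \<omega>)" "- (2 * \<delta> J)"] bdd_uminus[OF min_bdd] by metis
    interpret prob_space P by (rule P_prob[OF P(1)])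
    have meas: "(\<lambda>\<omega>. block z j (\<lambda>i. X i \<omega>)) \<in> borel_measurable P" for j
      using measurable_mono[OF order_refl refl sub] block_measurable[of z j, OF z(1)]
      by (auto simp: P_measurable[OF P(1)])
    define A where "A d = {\<omega> \<in> space P. \<exists>j\<in>{J..<J + d}. 1 \<le> block z j (\<lambda>i. X i \<omega>)}" for d
    have A_sets: "A d \<in> sets P" for d
    proof -
      have "{\<omega> \<in> space P. 1 \<le> block z j (\<lambda>i. X i \<omega>)} \<in> sets P" for j
        by (rule borel_measurable_le[OF _ meas]) simp
      moreover have "A d = (\<Union>j\<in>{J..<J + d}. {\<omega> \<in> space P. 1 \<le> block z j (\<lambda>i. X i \<omega>)})"
        unfolding A_def by auto
      ultimately show ?thesis by simp
    qed
    have A_le: "prob (A d) \<le> 2 * \<delta> J" for d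
    proof -
      have "prob (A d) = (\<integral>\<omega>. indicator (A d) \<omega> \<partial>P)"
        using sets.sets_into_space[OF A_sets, of d] by (simp add: Int_absorb2)
      also have "\<dots> \<le> (\<integral>\<omega>. min 1 (S d \<omega>) \<partial>P)"
      proof (rule integral_mono)
        show "integrable P (indicator (A d) :: 'a \<Rightarrow> real)" using A_sets[of d] by (simp add: less_top[symmetric])
        show "integrable P (\<lambda>\<omega>. min 1 (S d \<omega>))" by (rule P_integrable_bdd[OF P(1) min_bdd])
        \<comment> \<open>One block with value at least 1 already pushes the sum of nonnegative
          blocks to 1, and the cap at 1 does no harm.\<close>
        show "indicator (A d) \<omega> \<le> min 1 (S d \<omega>)" for \<omega>
        proof (cases "\<omega> \<in> A d")
          case True
          then obtain j where j: "j \<in> {J..<J + d}" "1 \<le> block z j (\<lambda>i. X i \<omega>)" unfolding A_def by blast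
          have "block z j (\<lambda>i. X i \<omega>) \<le> S d \<omega>"
            unfolding S_def using j(1) block0 by (intro member_le_sum) auto
          then show ?thesis using True j(2) by simp
        qed (use S0 in simp)
      qed
      also have "\<dots> \<le> 2 * \<delta> J" using P(2)[of d] by simp
      finally show ?thesis .
    qed
    have "incseq A" unfolding A_def by (intro incseq_SucI) auto
    then have "(\<lambda>d. prob (A d)) \<longlonglongrightarrow> prob (\<Union>d. A d)"
      using A_sets by (intro finite_Lim_measure_incseq) auto
    then have "prob (\<Union>d. A d) \<le> 2 * \<delta> J"
      by (rule LIMSEQ_le_const2) (use A_le in blast)
    moreover have "prob (space P - (\<Union>d. A d)) = 1 - prob (\<Union>d. A d)"
      using A_sets by (intro prob_compl) auto
    moreover have "prob (space P - (\<Union>d. A d)) \<le> prob (eventually_small z)"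
    proof (rule finite_measure_mono)
      show "space P - (\<Union>d. A d) \<subseteq> eventually_small z"
      proof
        fix \<omega> assume \<omega>: "\<omega> \<in> space P - (\<Union>d. A d)"
        have "block z j (\<lambda>i. X i \<omega>) < 1" if "J \<le> j" for j
        proof -
          have "\<omega> \<notin> A (Suc (j - J))" using \<omega> by blast
          then show ?thesis using \<omega> that unfolding A_def by (auto simp: not_le)
        qed
        then show "\<omega> \<in> eventually_small z"
          using \<omega> unfolding eventually_small_def by (auto simp: P_space[OF P(1)])
      qed
      show "eventually_small z \<in> sets P"
        using eventually_small_sets[of z, OF z(1)] sub unfolding P_sets[OF P(1)] by blast
    qed
    ultimately have "1 - 2 * \<delta> J \<le> prob (eventually_small z)" by linarith
    also have "ereal (prob (eventually_small z)) \<le> V_fam \<P> (eventually_small z)"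
      unfolding V_fam_def by (rule SUP_upper[OF P(1)])
    finally show ?thesis by simp
  qed
  have "(\<lambda>J. 1 - 2 * \<delta> J) \<longlonglongrightarrow> 1 - 2 * (0 / (1 - q))"
    unfolding \<delta>_def using q by (intro tendsto_intros LIMSEQ_power_zero) auto
  then have "(\<lambda>J. ereal (1 - 2 * \<delta> J)) \<longlonglongrightarrow> 1"
    by (simp add: one_ereal_def)
  then show ?thesis
    by (rule LIMSEQ_le_const2) (use lower in blast)
qed

text \<open>Centring at the midpoint of the lower and upper means makes the upper expectations of
  \<open>u\<close> and \<open>- u\<close> equal. Under scaling by \<eta> the bound for the square of
  \<open>u\<close> is quadratic in \<eta> while \<open>e\<close> is linear, so a small \<eta> gives
  the square bound.\<close>

lemma normalised_observable:
  assumes \<psi>: "\<psi> \<in> C_bLip 1"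
    and ne: "Er (\<lambda>\<omega>. - \<psi> (\<lambda>_. X 0 \<omega>)) \<noteq> - Er (\<lambda>\<omega>. \<psi> (\<lambda>_. X 0 \<omega>))"
  obtains u e where "u \<in> C_bLip 1" "0 < e" "e < 1" "\<And>x. (u x)\<^sup>2 \<le> 1 - (1 - e / 2)\<^sup>2"
    "Er (\<lambda>\<omega>. u (\<lambda>_. X 0 \<omega>)) = e" "Er (\<lambda>\<omega>. - u (\<lambda>_. X 0 \<omega>)) = e"
proof -
  obtain K where K: "\<And>x. \<bar>\<psi> x\<bar> \<le> K" using \<psi> by (elim C_bLipE) blast
  let ?Y = "\<lambda>\<omega>. \<psi> (\<lambda>_. X 0 \<omega>)"
  have Y: "?Y \<in> H_bdd M H" "(\<lambda>\<omega>. - ?Y \<omega>) \<in> H_bdd M H"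
    using bdd_X1[OF \<psi>] bdd_uminus by blast+
  \<comment> \<open>The upper mean is \<open>a\<close> and the lower mean \<open>- b\<close>;
    \<open>c\<close> is their midpoint and \<epsilon> half of the gap.\<close>
  define a b c \<epsilon> where "a = Er ?Y" and "b = Er (\<lambda>\<omega>. - ?Y \<omega>)"
    and "c = (a - b) / 2" and "\<epsilon> = (a + b) / 2"
  have "\<epsilon> > 0" using ne Er_neg_ge[OF Y(1)] unfolding a_def b_def \<epsilon>_def by simp
  have K': "- K \<le> \<psi> x" "\<psi> x \<le> K" for x using K[of x] by (auto simp: abs_le_iff)
  have "a \<le> Er (\<lambda>_. K)" "b \<le> Er (\<lambda>_. K)" "Er (\<lambda>_. - K) \<le> a" "Er (\<lambda>_. - K) \<le> b"
    unfolding a_def b_def using K' by (intro Er_mono Y bdd_const; simp add: minus_le_iff)+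
  then have c: "\<bar>c\<bar> \<le> K" unfolding c_def Er_const by (simp add: abs_le_iff)
  have "K \<ge> 0" using c by simp
  \<comment> \<open>The term \<open>4 * K\<^sup>2\<close> bounds the square of
    \<open>\<psi> - c\<close>; \<open>\<epsilon>\<^sup>2\<close> covers the quadratic term of the
    target and makes \<open>\<eta> * \<epsilon>\<close> less than 1; the summand 1 ensures
    strictness.\<close>
  define D \<eta> where "D = 4 * K\<^sup>2 + \<epsilon>\<^sup>2 + 1" and "\<eta> = \<epsilon> / D"
  have D: "D > 0" unfolding D_def by (intro add_nonneg_pos) auto
  have \<eta>: "\<eta> > 0" "\<eta> * D = \<epsilon>" unfolding \<eta>_def using D \<open>\<epsilon> > 0\<close> by auto
  let ?u = "\<lambda>x. - (\<eta> * c) + \<eta> * \<psi> x"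
  show ?thesis
  proof (rule that[of ?u "\<eta> * \<epsilon>"])
    show "?u \<in> C_bLip 1" by (intro C_bLip_add C_bLip_const C_bLip_scale \<psi>)
    show "0 < \<eta> * \<epsilon>" using \<eta> \<open>\<epsilon> > 0\<close> by simp
    have "\<eta> * \<epsilon> * D = \<epsilon>\<^sup>2" using \<eta>(2) by (simp add: power2_eq_square algebra_simps)
    also have "\<dots> < 1 * D" unfolding D_def by (simp add: add_nonneg_pos)
    finally show "\<eta> * \<epsilon> < 1" using D by (simp only: mult_less_cancel_right_pos)
    show "(?u x)\<^sup>2 \<le> 1 - (1 - \<eta> * \<epsilon> / 2)\<^sup>2" for x
    proof -
      have "\<bar>\<psi> x - c\<bar> \<le> 2 * K" using K[of x] c by linarith
      then have "(\<psi> x - c)\<^sup>2 \<le> (2 * K)\<^sup>2" using power_mono[of "\<bar>\<psi> x - c\<bar>" "2 * K" 2] by simp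
      then have "\<eta>\<^sup>2 * (\<psi> x - c)\<^sup>2 \<le> \<eta>\<^sup>2 * (2 * K)\<^sup>2" by (intro mult_left_mono) auto
      also have "\<dots> \<le> \<eta>\<^sup>2 * (D - \<epsilon>\<^sup>2 / 4)"
        unfolding D_def by (intro mult_left_mono) auto
      also have "\<dots> = \<eta> * (\<eta> * D) - \<eta>\<^sup>2 * \<epsilon>\<^sup>2 / 4" by (simp add: power2_eq_square algebra_simps)
      also have "\<dots> = 1 - (1 - \<eta> * \<epsilon> / 2)\<^sup>2"
        unfolding \<eta>(2) by (simp add: power2_eq_square field_simps)
      also have "\<eta>\<^sup>2 * (\<psi> x - c)\<^sup>2 = (?u x)\<^sup>2" by (simp add: power2_eq_square algebra_simps)
      finally show ?thesis .
    qed
    have "Er (\<lambda>\<omega>. ?u (\<lambda>_. X 0 \<omega>)) = - (\<eta> * c) + \<eta> * a"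
      unfolding a_def using \<eta> by (intro Er_affine Y) simp
    then show "Er (\<lambda>\<omega>. ?u (\<lambda>_. X 0 \<omega>)) = \<eta> * \<epsilon>"
      unfolding c_def \<epsilon>_def by (simp add: field_simps)
    have "Er (\<lambda>\<omega>. \<eta> * c + \<eta> * - ?Y \<omega>) = \<eta> * c + \<eta> * b"
      unfolding b_def using \<eta> by (intro Er_affine Y) simp
    moreover have "(\<lambda>\<omega>. - ?u (\<lambda>_. X 0 \<omega>)) = (\<lambda>\<omega>. \<eta> * c + \<eta> * - ?Y \<omega>)" by auto
    moreover have "\<eta> * c + \<eta> * b = \<eta> * \<epsilon>" unfolding c_def \<epsilon>_def by (simp add: field_simps)
    ultimately show "Er (\<lambda>\<omega>. - ?u (\<lambda>_. X 0 \<omega>)) = \<eta> * \<epsilon>" by simp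
  qed
qed

text \<open>Each \<open>m\<close> gets its own sequence of signs. Where two sequences have opposite
  signs, the product of the two blocks is at least 1, so both cannot be below 1; this happens for
  arbitrarily large block indices.\<close>

lemma disjoint_full_events:
  assumes \<psi>: "\<psi> \<in> C_bLip 1"
    and ne: "Er (\<lambda>\<omega>. - \<psi> (\<lambda>_. X 0 \<omega>)) \<noteq> - Er (\<lambda>\<omega>. \<psi> (\<lambda>_. X 0 \<omega>))"
  obtains B :: "nat \<Rightarrow> 'a set"
  where "\<And>m. B m \<in> sets (sigma_gen M (range X))" "\<And>m. 1 \<le> V_fam \<P> (B m)"
    and "\<And>m m'. m \<noteq> m' \<Longrightarrow> B m \<inter> B m' = {}"
proof -
  obtain u e where u: "u \<in> C_bLip 1" and e: "0 < e" "e < 1"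
    and u2: "\<And>x. (u x)\<^sup>2 \<le> 1 - (1 - e / 2)\<^sup>2"
    and Eu: "Er (\<lambda>\<omega>. u (\<lambda>_. X 0 \<omega>)) = e" "Er (\<lambda>\<omega>. - u (\<lambda>_. X 0 \<omega>)) = e"
    using normalised_observable[OF assms] by blast
  \<comment> \<open>The factors \<open>(1 - u) / r\<close> and \<open>(1 + u) / r\<close> have lower
    expectation \<open>(1 - e) / r\<close>, which is below 1 as \<open>r > 1 - e\<close>; the square
    bound for \<open>u\<close> says that their product is at least 1.\<close>
  define r q where "r = 1 - e / 2" and "q = (1 - e) / r"
  have r: "0 < r" using e unfolding r_def by simp
  have q: "0 < q" "q < 1" unfolding q_def using e r by (auto simp: r_def)
  \<comment> \<open>Row \<open>m\<close> has sign 1 exactly at the codes of pairs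
    \<open>(m, k)\<close>, so distinct rows have opposite signs infinitely often.\<close>
  define s :: "nat \<Rightarrow> nat \<Rightarrow> real" where "s m j = (if fst (prod_decode j) = m then 1 else - 1)" for m j
  have s_cases: "s m j = 1 \<or> s m j = - 1" for m j unfolding s_def by simp
  define z where "z m j x = 1 / r - 1 / r * (s m j * u x)" for m j x
  have z_alt: "z m j x = (1 - s m j * u x) / r" for m j x
    unfolding z_def by (simp add: diff_divide_distrib)
  have z: "z m j \<in> C_bLip 1" for m j
    using C_bLip_add[OF C_bLip_const[of "1 / r"] C_bLip_scale[OF u, of "- (1 / r * s m j)"]]
    unfolding z_def[abs_def] by (simp add: algebra_simps)
  have u1: "\<bar>u x\<bar> \<le> 1" for x
  proof -
    have "(u x)\<^sup>2 \<le> 1" using u2[of x] by (rule order_trans) simp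
    then show ?thesis by (simp add: abs_square_le_1)
  qed
  have z0: "0 \<le> z m j x" for m j x
    unfolding z_alt using s_cases[of m j] u1[of x] r by (auto intro!: divide_nonneg_pos simp: abs_le_iff)
  have zq: "- q \<le> Er (\<lambda>\<omega>. - z m j (\<lambda>_. X k \<omega>))" for m j k
  proof -
    have su: "(\<lambda>x. s m j * u x) \<in> C_bLip 1" by (rule C_bLip_scale[OF u])
    have "Er (\<lambda>\<omega>. s m j * u (\<lambda>_. X k \<omega>)) = e"
      using Er_X1[OF su, of k] Eu s_cases[of m j] by auto
    then have "Er (\<lambda>\<omega>. - (1 / r) + 1 / r * (s m j * u (\<lambda>_. X k \<omega>))) = - (1 / r) + 1 / r * e"
      using r by (subst Er_affine[OF bdd_X1[OF su]]) auto
    moreover have "- q = - (1 / r) + 1 / r * e" unfolding q_def by (simp add: diff_divide_distrib)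
    ultimately show ?thesis unfolding z_def by simp
  qed
  show ?thesis
  proof (rule that[of "\<lambda>m. eventually_small (z m)"])
    show "eventually_small (z m) \<in> sets (sigma_gen M (range X))" for m
      by (rule eventually_small_sets[OF z])
    show "1 \<le> V_fam \<P> (eventually_small (z m))" for m
      by (rule eventually_small_V_fam[OF z z0 q zq])
    show "eventually_small (z m) \<inter> eventually_small (z m') = {}" if "m \<noteq> m'" for m m'
    proof (rule ccontr)
      assume "eventually_small (z m) \<inter> eventually_small (z m') \<noteq> {}"
      then obtain \<omega> J J' where J: "\<And>j. j \<ge> J \<Longrightarrow> block (z m) j (\<lambda>i. X i \<omega>) < 1"
        "\<And>j. j \<ge> J' \<Longrightarrow> block (z m') j (\<lambda>i. X i \<omega>) < 1"
        unfolding eventually_small_def by auto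
      \<comment> \<open>A code in row \<open>m\<close> lying beyond both thresholds; there
        \<open>m\<close> has sign 1 and \<open>m'\<close> has sign -1.\<close>
      define j where "j = prod_encode (m, max J J')"
      have "max J J' \<le> j" unfolding j_def by (rule le_prod_encode_2)
      then have lt: "block (z m) j (\<lambda>i. X i \<omega>) < 1" "block (z m') j (\<lambda>i. X i \<omega>) < 1"
        using J by auto
      have s: "s m j = 1" "s m' j = - 1" using that unfolding s_def j_def by auto
      have "1 \<le> z m j x * z m' j x" for x
      proof -
        have "r\<^sup>2 \<le> 1 - (u x)\<^sup>2" using u2[of x] unfolding r_def by simp
        also have "\<dots> = (1 - u x) * (1 + u x)" by (simp add: power2_eq_square algebra_simps)
        finally show ?thesis
          unfolding z_alt s using r by (simp add: power2_eq_square le_divide_eq)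
      qed
      then have "1 \<le> block (z m) j (\<lambda>i. X i \<omega>) * block (z m') j (\<lambda>i. X i \<omega>)"
        unfolding block_def prod.distrib[symmetric] by (intro prod_ge_1)
      also have "\<dots> < 1 * 1"
        using lt z0 unfolding block_def by (intro mult_strict_mono' prod_nonneg) auto
      finally show False by simp
    qed
  qed
qed

text \<open>If some one-variable observable had no certain mean, the tail unions \<open>A n\<close>
  of disjoint events of full capacity would all have capacity 1 and decrease to the empty set, whose
  capacity is not positive.\<close>

lemma linear_on_H_tilde:
  assumes V: "admissible V \<A>"
    and dec: "decreasing_property V (sets (sigma_gen M (range X)))"
  shows "linear_expectation_on (H_tilde E X) E"
proof (intro linear_expectation_onI mean_certain_H_tilde)
  fix \<psi> assume \<psi>: "\<psi> \<in> C_bLip 1"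
  show "Er (\<lambda>\<omega>. - \<psi> (\<lambda>_. X 0 \<omega>)) = - Er (\<lambda>\<omega>. \<psi> (\<lambda>_. X 0 \<omega>))"
  proof (rule ccontr)
    assume "\<not> ?thesis"
    then obtain B :: "nat \<Rightarrow> 'a set" where B: "\<And>m. B m \<in> sets (sigma_gen M (range X))"
      and B1: "\<And>m. 1 \<le> V_fam \<P> (B m)" and disj: "\<And>m m'. m \<noteq> m' \<Longrightarrow> B m \<inter> B m' = {}"
      using disjoint_full_events[OF \<psi>] by blast
    have sub: "sets (sigma_gen M (range X)) \<subseteq> sets (sigma_gen M H)"
      by (rule sigma_gen_mono) (use X_H in auto)
    have V_ge: "V_fam \<P> A \<le> V A" and in\<A>: "A \<in> \<A>" if "A \<in> sets (sigma_gen M H)" for A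
      using V that unfolding admissible_def by auto
    \<comment> \<open>The zero function serves as the lower function in the two-sided sandwich
      property.\<close>
    have sandwich: "V A \<le> E g" if "A \<in> \<A>" "g \<in> H" "\<And>\<omega>. \<omega> \<in> space M \<Longrightarrow> indicator A \<omega> \<le> g \<omega>" for A g
    proof -
      have "\<forall>\<omega>\<in>space M. (0::real) \<le> indicator A \<omega> \<and> indicator A \<omega> \<le> g \<omega>"
        using that(3) by simp
      moreover have "sandwich_property M H E V \<A>" using V unfolding admissible_def by blast
      note bspec[OF bspec[OF bspec[OF this[unfolded sandwich_property_def] that(1)] zero] that(2)]
      ultimately show ?thesis by simp
    qed
    define A where "A n = (\<Union>m\<in>{n..}. B m)" for n
    have A: "A n \<in> sets (sigma_gen M (range X))" for n unfolding A_def using B by auto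
    then have AH: "A n \<in> sets (sigma_gen M H)" for n using sub by blast
    have "V (A n) = 1" for n
    proof (rule antisym)
      show "V (A n) \<le> 1"
        using sandwich[OF in\<A>[OF AH] H_const, of n 1] E_const[of 1] by (simp add: one_ereal_def indicator_le_1)
      have "measure P (B n) \<le> measure P (A n)" if P: "P \<in> \<P>" for P
      proof -
        interpret prob_space P by (rule P_prob[OF P])
        show ?thesis
          using AH[of n] P_sets[OF P] unfolding A_def by (intro finite_measure_mono) auto
      qed
      then have "V_fam \<P> (B n) \<le> V_fam \<P> (A n)"
        unfolding V_fam_def by (intro SUP_subset_mono[OF order_refl]) auto
      then show "1 \<le> V (A n)" using B1[of n] V_ge[OF AH[of n]] by (blast intro: order_trans)
    qed
    moreover have "A (Suc n) \<subseteq> A n" for n unfolding A_def by (intro UN_mono) auto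
    ultimately have "0 < V (\<Inter>n. A n)" using dec A unfolding decreasing_property_def by blast
    moreover have "(\<Inter>n. A n) = {}"
    proof (rule ccontr)
      assume "(\<Inter>n. A n) \<noteq> {}"
      then obtain \<omega> where \<omega>: "\<And>n. \<omega> \<in> A n" by auto
      obtain m where m: "\<omega> \<in> B m" using \<omega>[of 0] unfolding A_def by auto
      obtain m' where m': "m' \<ge> Suc m" "\<omega> \<in> B m'" using \<omega>[of "Suc m"] unfolding A_def by auto
      then show False using disj[of m m'] m by auto
    qed
    moreover have "V {} \<le> 0"
      using sandwich[OF in\<A> zero, of "{}"] E_const[of 0] by (simp add: zero_ereal_def)
    ultimately show False by simp
  qed
qed

end

section \<open>Sandwich property and linearity for each of the four capacities\<close>

theorem proposition4p2:
  fixes M :: "'a measure" and H :: "('a \<Rightarrow> real) set" and E :: "('a \<Rightarrow> real) \<Rightarrow> ereal"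
    and X :: "nat \<Rightarrow> 'a \<Rightarrow> real" and \<P> :: "'a measure set"
  assumes "sublinear_expectation_space M H E"
    and "\<And>n. X n \<in> H"
    and "indep_seq H E X"
    and "ident_distr_seq E X"
    and "condition_CC M H E \<P>"
  shows "\<forall>(V, \<A>) \<in> {(V_fam \<P>, sets (sigma_gen M H)), (C_star M H E, sets M),
                      (V_hat_star M H E, sets M), (V_hat M H E, sets M)}.
           sandwich_property M H E V \<A> \<and>
           (decreasing_property V (sets (sigma_gen M (range X)))
              \<longrightarrow> linear_expectation_on (H_tilde E X) E)"
proof -
  interpret sublinear_expectation_space M H E by (rule assms(1))
  interpret iid_CC_space M H E \<P> X by unfold_locales (use assms in auto)
  show ?thesis
  proof (rule ballI)
    fix p assume p: "p \<in> {(V_fam \<P>, sets (sigma_gen M H)), (C_star M H E, sets M),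
        (V_hat_star M H E, sets M), (V_hat M H E, sets M)}"
    obtain V \<A> where V: "p = (V, \<A>)" by (cases p)
    have adm: "admissible V \<A>"
      using bspec[OF admissible_capacities p] unfolding V case_prod_conv .
    then have "sandwich_property M H E V \<A>" unfolding admissible_def by (elim conjE)
    with linear_on_H_tilde[OF adm] show "case p of (V, \<A>) \<Rightarrow> sandwich_property M H E V \<A> \<and>
        (decreasing_property V (sets (sigma_gen M (range X)))
          \<longrightarrow> linear_expectation_on (H_tilde E X) E)"
      unfolding V case_prod_conv by (intro conjI impI)
  qed
qed

end
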